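(* Let $\mathcal{K}_1,\dots,\mathcal{K}_N$ be convex bodies in $\mathbb{R}^n$ and let $f\colon\mathbb{R}^n\to\mathbb{R}^{N\times N}$ be a matrix-valued function whose every component $f_{ij}$ is a Schwartz function. Suppose that: (i) the matrix $\bigl(\hat f_{ij}(0)-(\operatorname{vol}\mathcal{K}_i)^{1/2}(\operatorname{vol}\mathcal{K}_j)^{1/2}\bigr)_{i,j=1}^N$ is positive semidefinite; (ii) the matrix of Fourier transforms $\bigl(\hat f_{ij}(u)\bigr)_{i,j=1}^N$ is positive semidefinite for every $u\in\mathbb{R}^n\setminus\{0\}$; (iii) for all $i,j$ and $x\in\mathbb{R}^n$, $f_{ij}(x)\le 0$ whenever $\mathcal{K}_i^\circ\cap(x+\mathcal{K}_j^\circ)=\emptyset$. Then the (upper) density of any packing of translates of $\mathcal{K}_1,\dots,\mathcal{K}_N$ in $\mathbb{R}^n$ is at most $\max\{f_{ii}(0): i=1,\dots,N\}$.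
   Context: A convex body is a compact convex set with nonempty interior; $\mathcal{K}^\circ$ denotes the topological interior. The Fourier transform of an $L^1$ function $g\colon\mathbb{R}^n\to\mathbb{C}$ is $\hat g(u)=\int_{\mathbb{R}^n}g(x)e^{-2\pi \mathrm{i}\,u\cdot x}\,dx$. Positive semidefinite complex matrices are Hermitian. A packing of translates of $\mathcal{K}_1,\dots,\mathcal{K}_N$ is a union $\mathcal{P}$ of translated copies of these bodies (each body may be used any number of times) in which any two copies have disjoint interiors. Its density is $\Delta$ if for all $p\in\mathbb{R}^n$ one has $\Delta=\lim_{r\to\infty}\operatorname{vol}(B(p,r)\cap\mathcal{P})/\operatorname{vol}B(p,r)$, where $B(p,r)$ is the ball of radius $r$ centered at $p$. Not every packing has a density, but every packing has an upper density $$\limsup_{r\to\infty}\ \sup_{p\in\mathbb{R}^n}\frac{\operatorname{vol}(B(p,r)\cap\mathcal{P})}{\operatorname{vol}B(p,r)}.$$ *)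

theory Defs
  imports "HOL-Analysis.Analysis"
begin

abbreviation vol :: "(real ^ 'n) set \<Rightarrow> real" where
  "vol A \<equiv> measure lborel A"

definition convex_body :: "(real ^ 'n) set \<Rightarrow> bool" where
  "convex_body K \<longleftrightarrow> compact K \<and> convex K \<and> interior K \<noteq> {}"

definition partial_deriv :: "'n \<Rightarrow> (real ^ 'n \<Rightarrow> real) \<Rightarrow> real ^ 'n \<Rightarrow> real" where
  "partial_deriv k g x = frechet_derivative g (at x) (axis k 1)"

definition iter_partial_deriv :: "'n list \<Rightarrow> (real ^ 'n \<Rightarrow> real) \<Rightarrow> real ^ 'n \<Rightarrow> real" where
  "iter_partial_deriv ks g = foldr partial_deriv ks g"

(* Differentiability of all iterated partial derivatives is C-infinity smoothness:
   the partial derivatives of every order exist and, being differentiable, are continuous.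
   Since frechet_derivative is an unspecified value at points of non-differentiability,
   the decay condition is meaningful only together with smoothness.  The lists ks run over
   all orders of differentiation, so they cover all multi-indices. *)
definition smooth :: "(real ^ 'n \<Rightarrow> real) \<Rightarrow> bool" where
  "smooth g \<longleftrightarrow> (\<forall>ks. iter_partial_deriv ks g differentiable_on UNIV)"

definition schwartz :: "(real ^ 'n \<Rightarrow> real) \<Rightarrow> bool" where
  "schwartz g \<longleftrightarrow> smooth g \<and>
     (\<forall>(\<alpha> :: 'n \<Rightarrow> nat) ks.
        bounded (range (\<lambda>x. (\<Prod>k\<in>UNIV. (x $ k) ^ \<alpha> k) * iter_partial_deriv ks g x)))"

definition fourier :: "(real ^ 'n \<Rightarrow> complex) \<Rightarrow> real ^ 'n \<Rightarrow> complex" where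
  "fourier g u = (LINT x|lborel. g x * exp (- 2 * of_real pi * \<i> * of_real (u \<bullet> x)))"

definition psd :: "complex ^ 'm ^ 'm \<Rightarrow> bool" where
  "psd M \<longleftrightarrow> (\<forall>i j. M $ i $ j = cnj (M $ j $ i)) \<and>
     (\<forall>v :: complex ^ 'm. (\<Sum>i\<in>UNIV. \<Sum>j\<in>UNIV. cnj (v $ i) * M $ i $ j * v $ j) \<in> \<real>\<^sub>\<ge>\<^sub>0)"

(* P is the union of the packing; C is the collection of translated copies. *)
definition translative_packing :: "('m \<Rightarrow> (real ^ 'n) set) \<Rightarrow> (real ^ 'n) set \<Rightarrow> bool" where
  "translative_packing K P \<longleftrightarrow>
     (\<exists>C. C \<subseteq> {(+) t ` K i | t i. True} \<and>
          pairwise (\<lambda>A B. disjnt (interior A) (interior B)) C \<and>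
          P = \<Union>C)"

definition has_density :: "(real ^ 'n) set \<Rightarrow> real \<Rightarrow> bool" where
  "has_density P \<Delta> \<longleftrightarrow>
     (\<forall>p. ((\<lambda>r. vol (ball p r \<inter> P) / vol (ball p r)) \<longlongrightarrow> \<Delta>) at_top)"

definition upper_density :: "(real ^ 'n) set \<Rightarrow> ereal" where
  "upper_density P =
     Limsup at_top (\<lambda>r. SUP p. ereal (vol (ball p r \<inter> P) / vol (ball p r)))"

end

theory Submission
  imports Defs "HOL-Probability.Probability"
begin

text \<open>
  Positive semidefiniteness of the Fourier transforms makes \<open>f\<close> a positive definite matrix kernel, so
  its quadratic form is nonnegative on finite signed measures. Take the copies \<open>t\<^sub>a + K\<^bsub>c(a)\<^esub>\<close> that meet
  a ball of radius \<open>r\<close>, put mass \<open>sqrt (vol K\<^bsub>c(a)\<^esub>)\<close> at \<open>t\<^sub>a\<close>, and subtract the same masses spread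
  uniformly over a slightly larger ball \<open>B\<close>. Up to boundary terms, every integral against the uniform
  part is the total integral of \<open>f\<close> divided by \<open>vol B\<close>, so the point masses alone give at least
  \<open>m\<^sup>T F m / vol B\<close>, where \<open>F\<close> is the Fourier transform at \<open>0\<close> and \<open>m\<close> collects the masses by type.
  By hypothesis (i) this is at least \<open>V\<^sup>2 / vol B\<close>, where \<open>V\<close> is the total volume of the copies, and by
  hypothesis (iii) the point masses give at most \<open>V\<close> times the largest \<open>f\<^sub>i\<^sub>i(0)\<close>. Dividing by \<open>V\<close> bounds
  the density, and no Poisson summation or periodic approximation is needed.
\<close>

section \<open>Gaussian averages of the Fourier transform\<close>

lemma std_normal_char_integral:
  "(\<integral>x. exp (\<i> * of_real (t * x)) \<partial>std_normal_distribution) = of_real (exp (- (t\<^sup>2) / 2))"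
  using fun_cong[OF char_std_normal_distribution, of t] by (simp add: char_def)

lemma exp_norm_sq_prod: "exp (- (norm (z::'a::euclidean_space))\<^sup>2 / 2) = (\<Prod>b\<in>Basis. exp (- (z \<bullet> b)\<^sup>2 / 2))"
proof -
  have "(norm z)\<^sup>2 = (\<Sum>b\<in>Basis. (z \<bullet> b)\<^sup>2)"
    unfolding power2_norm_eq_inner by (subst euclidean_inner) (simp add: power2_eq_square)
  then show ?thesis
    by (simp add: exp_sum[symmetric] sum_negf sum_divide_distrib[symmetric])
qed

text \<open>Under a product of one-dimensional standard normals, pushed forward to the space, the
  characteristic function factors over the coordinates. The identity is later read backwards: it
  writes a Gaussian weight as an average of characters.\<close>

lemma standard_gaussian_exists:
  obtains N :: "'a::euclidean_space measure"
  where "prob_space N" "sets N = sets borel"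
    "\<And>z. (\<integral>x. exp (\<i> * of_real (z \<bullet> x)) \<partial>N) = of_real (exp (- (norm z)\<^sup>2 / 2))"
proof -
  let ?P = "\<Pi>\<^sub>M b\<in>(Basis::'a set). std_normal_distribution"
  let ?S = "\<lambda>f. \<Sum>b\<in>Basis. f b *\<^sub>R b :: 'a"
  interpret nd: prob_space "density lborel std_normal_density"
    by (simp add: prob_space_normal_density)
  interpret product_prob_space "\<lambda>_::'a. density lborel std_normal_density" ..
  have P: "prob_space ?P"
    by (rule prob_space_PiM) (rule nd.prob_space_axioms)
  have S[measurable]: "?S \<in> ?P \<rightarrow>\<^sub>M borel"
    by measurable
  let ?N = "distr ?P borel ?S"
  have "(\<integral>x. exp (\<i> * of_real (z \<bullet> x)) \<partial>?N) = of_real (exp (- (norm z)\<^sup>2 / 2))" for z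
  proof -
    have "(\<integral>x. exp (\<i> * of_real (z \<bullet> x)) \<partial>?N) = (\<integral>f. exp (\<i> * of_real (z \<bullet> ?S f)) \<partial>?P)"
      by (rule integral_distr) measurable
    also have "\<dots> = (\<integral>f. (\<Prod>b\<in>Basis. exp (\<i> * of_real ((z \<bullet> b) * f b))) \<partial>?P)"
      by (simp add: inner_sum_right sum_distrib_left exp_sum mult.commute)
    also have "\<dots> = (\<Prod>b\<in>Basis. \<integral>x. exp (\<i> * of_real ((z \<bullet> b) * x)) \<partial>std_normal_distribution)"
    proof (rule product_integral_prod)
      show "integrable std_normal_distribution (\<lambda>x. exp (\<i> * of_real ((z \<bullet> b) * x)))" for b
        by (rule nd.integrable_const_bound[where B=1]) (auto simp: norm_exp_i_times)
    qed simp
    also have "\<dots> = (\<Prod>b\<in>Basis. of_real (exp (- ((z \<bullet> b)\<^sup>2) / 2)))"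
      by (simp only: std_normal_char_integral)
    also have "\<dots> = of_real (exp (- (norm z)\<^sup>2 / 2))"
      by (simp only: exp_norm_sq_prod of_real_prod)
    finally show ?thesis .
  qed
  moreover have "prob_space ?N"
    by (rule prob_space.prob_space_distr[OF P S])
  ultimately show ?thesis
    by (intro that[of ?N]) auto
qed

text \<open>Replacing the Gaussian weight by an average of characters and swapping the integrals
  leaves the Fourier transform of \<open>g\<close> at a random frequency. Fubini applies because
  \<open>g\<close> is integrable and characters have modulus one.\<close>

lemma fourier_gaussian_weight:
  fixes g :: "real ^ 'n::finite \<Rightarrow> real"
  assumes N: "prob_space N" "sets N = sets borel"
    and char: "\<And>z. (\<integral>x. exp (\<i> * of_real (z \<bullet> x)) \<partial>N) = of_real (exp (- (norm z)\<^sup>2 / 2))"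
    and g: "integrable lborel g"
  shows "of_real (\<integral>z. g z * exp (- (norm (k *\<^sub>R (z - w)))\<^sup>2 / 2) \<partial>lborel) =
    (\<integral>x. exp (- (\<i> * of_real (k * (w \<bullet> x)))) * fourier (\<lambda>z. of_real (g z)) (- (k / (2 * pi)) *\<^sub>R x) \<partial>N)"
proof -
  interpret N: prob_space N by fact
  note [measurable_cong] = N(2)
  note [measurable] = borel_measurable_integrable[OF g]
  interpret pair_sigma_finite lborel N ..
  let ?h = "\<lambda>z x. complex_of_real (g z) * exp (\<i> * of_real ((k *\<^sub>R (z - w)) \<bullet> x))"
  have int: "integrable (lborel \<Otimes>\<^sub>M N) (case_prod ?h)"
  proof (rule Fubini_integrable)
    show "case_prod ?h \<in> borel_measurable (lborel \<Otimes>\<^sub>M N)"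
      by measurable
    show "integrable lborel (\<lambda>z. \<integral>x. norm (case_prod ?h (z, x)) \<partial>N)"
      using g by (simp add: norm_mult norm_exp_i_times N.prob_space)
    show "AE z in lborel. integrable N (\<lambda>x. case_prod ?h (z, x))"
      by (intro AE_I2 N.integrable_const_bound[where B="\<bar>g _\<bar>"]) (auto simp: norm_mult norm_exp_i_times)
  qed
  have "complex_of_real (\<integral>z. g z * exp (- (norm (k *\<^sub>R (z - w)))\<^sup>2 / 2) \<partial>lborel)
      = (\<integral>z. of_real (g z) * of_real (exp (- (norm (k *\<^sub>R (z - w)))\<^sup>2 / 2)) \<partial>lborel)"
    by (simp flip: of_real_mult)
  also have "\<dots> = (\<integral>z. \<integral>x. ?h z x \<partial>N \<partial>lborel)"
    by (simp only: char[symmetric] integral_mult_right_zero)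
  also have "\<dots> = (\<integral>x. \<integral>z. ?h z x \<partial>lborel \<partial>N)"
    by (rule Fubini_integral[OF int, symmetric])
  also have "\<dots> = (\<integral>x. exp (- (\<i> * of_real (k * (w \<bullet> x)))) * fourier (\<lambda>z. of_real (g z)) (- (k / (2 * pi)) *\<^sub>R x) \<partial>N)"
  proof (rule Bochner_Integration.integral_cong[OF refl])
    fix x
    \<comment> \<open>The frequency \<open>u = -(k / (2 pi)) x\<close> is chosen so that
      \<open>exp (-2 pi i u.z)\<close> equals \<open>exp (i k x.z)\<close>; the factor containing
      \<open>w\<close> comes out of the integral.\<close>
    have "?h z x = exp (- (\<i> * of_real (k * (w \<bullet> x)))) *
       (of_real (g z) * exp (- 2 * of_real pi * \<i> * of_real ((- (k / (2 * pi)) *\<^sub>R x) \<bullet> z)))" for z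
      by (simp add: exp_diff exp_minus inner_diff_left inner_diff_right ring_distribs divide_simps inner_commute[of x])
    then show "(\<integral>z. ?h z x \<partial>lborel) = exp (- (\<i> * of_real (k * (w \<bullet> x)))) * fourier (\<lambda>z. of_real (g z)) (- (k / (2 * pi)) *\<^sub>R x)"
      unfolding fourier_def by (simp only: integral_mult_right_zero)
  qed
  finally show ?thesis .
qed

text \<open>Sorting the indices by type turns a form over points into a form over types, to which
  positive semidefiniteness of the matrices applies.\<close>

lemma sum_bilinear_group:
  fixes c :: "'a \<Rightarrow> 'm::finite" and F :: "'m \<Rightarrow> 'm \<Rightarrow> 'c::comm_semiring_0"
  assumes "finite I"
  shows "(\<Sum>a\<in>I. \<Sum>b\<in>I. x a * F (c a) (c b) * y b) =
    (\<Sum>i\<in>UNIV. \<Sum>j\<in>UNIV. (\<Sum>a\<in>{a\<in>I. c a = i}. x a) * F i j * (\<Sum>b\<in>{b\<in>I. c b = j}. y b))"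
proof -
  have group: "(\<Sum>a\<in>I. h a) = (\<Sum>i\<in>UNIV. \<Sum>a\<in>{a\<in>I. c a = i}. h a)" for h :: "'a \<Rightarrow> 'c"
    using assms by (subst sum.group) auto
  have "(\<Sum>a\<in>I. \<Sum>b\<in>I. x a * F (c a) (c b) * y b) =
    (\<Sum>i\<in>UNIV. \<Sum>a\<in>{a\<in>I. c a = i}. \<Sum>b\<in>I. x a * F (c a) (c b) * y b)"
    by (rule group)
  also have "\<dots> = (\<Sum>i\<in>UNIV. \<Sum>a\<in>{a\<in>I. c a = i}. \<Sum>j\<in>UNIV. \<Sum>b\<in>{b\<in>I. c b = j}. x a * F (c a) (c b) * y b)"
    by (intro sum.cong refl group)
  also have "\<dots> = (\<Sum>i\<in>UNIV. \<Sum>a\<in>{a\<in>I. c a = i}. \<Sum>j\<in>UNIV. \<Sum>b\<in>{b\<in>I. c b = j}. x a * F i j * y b)"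
    by (intro sum.cong refl) auto
  also have "\<dots> = (\<Sum>i\<in>UNIV. \<Sum>j\<in>UNIV. \<Sum>a\<in>{a\<in>I. c a = i}. \<Sum>b\<in>{b\<in>I. c b = j}. x a * F i j * y b)"
    by (intro sum.cong refl sum.swap)
  finally show ?thesis
    by (simp add: sum_distrib_left[symmetric] sum_distrib_right[symmetric])
qed

section \<open>Gaussian integrals in several variables and Gaussian blurs\<close>

lemma integral_prod_Basis:
  fixes h :: "real \<Rightarrow> real"
  assumes h: "integrable lborel h"
  shows "integrable lborel (\<lambda>x::'a::euclidean_space. \<Prod>b\<in>Basis. h (x \<bullet> b))"
    and "(\<integral>x. (\<Prod>b\<in>Basis. h (x \<bullet> b)) \<partial>(lborel :: ('a) measure)) = (\<integral>t. h t \<partial>lborel) ^ DIM('a)"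
proof -
  interpret product_sigma_finite "\<lambda>_::'a. lborel :: real measure" ..
  note [measurable] = borel_measurable_integrable[OF h]
  have eq: "(\<Prod>b\<in>Basis. h ((\<Sum>b\<in>Basis. f b *\<^sub>R b :: 'a) \<bullet> b)) = (\<Prod>b\<in>Basis. h (f b))" for f :: "'a \<Rightarrow> real"
    by (intro prod.cong refl) simp
  show "integrable lborel (\<lambda>x::'a. \<Prod>b\<in>Basis. h (x \<bullet> b))"
    unfolding lborel_eq[where 'a='a]
    by (subst integrable_distr_eq) (auto simp: eq intro!: product_integrable_prod h)
  show "(\<integral>x. (\<Prod>b\<in>Basis. h (x \<bullet> b)) \<partial>(lborel :: ('a) measure)) = (\<integral>t. h t \<partial>lborel) ^ DIM('a)"
    unfolding lborel_eq[where 'a='a]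
    by (subst integral_distr) (auto simp: eq product_integral_prod[OF finite_Basis h])
qed

text \<open>Positivity is what matters: the value is the normalising constant of the blur and is
  divided out in \<open>form_nonneg\<close>.\<close>

lemma gaussian_integral:
  shows "integrable lborel (\<lambda>z::'a::euclidean_space. exp (- (norm z)\<^sup>2 / 2))"
    and "(\<integral>z. exp (- (norm z)\<^sup>2 / 2) \<partial>(lborel :: ('a) measure)) > 0"
proof -
  have eq: "exp (- t\<^sup>2 / 2) = sqrt (2 * pi) * std_normal_density t" for t
    by (simp add: std_normal_density_def)
  have i: "integrable lborel (\<lambda>t::real. exp (- t\<^sup>2 / 2))"
    unfolding eq by (intro integrable_mult_right) (simp add: integrable_normal_density)
  have v: "(\<integral>t. exp (- t\<^sup>2 / 2) \<partial>(lborel :: (real) measure)) = sqrt (2 * pi)"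
    unfolding eq by (simp add: integral_normal_density)
  show "integrable lborel (\<lambda>z::'a. exp (- (norm z)\<^sup>2 / 2))"
    unfolding exp_norm_sq_prod by (rule integral_prod_Basis(1)[OF i])
  show "(\<integral>z. exp (- (norm z)\<^sup>2 / 2) \<partial>(lborel :: ('a) measure)) > 0"
    unfolding exp_norm_sq_prod integral_prod_Basis(2)[OF i] v by simp
qed

text \<open>Convolution with a Gaussian of width \<open>1 / k\<close>, left unnormalised: the factor
  \<open>k ^ CARD('n)\<close> makes the total weight independent of \<open>k\<close>.\<close>

definition gauss_blur :: "real \<Rightarrow> (real ^ 'n \<Rightarrow> real) \<Rightarrow> real ^ 'n \<Rightarrow> real" where
  "gauss_blur k g w = (\<integral>z. g z * exp (- (norm (k *\<^sub>R (z - w)))\<^sup>2 / 2) \<partial>lborel)"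

lemma gauss_blur_measurable [measurable]:
  assumes [measurable]: "g \<in> borel_measurable borel"
  shows "gauss_blur k (g :: real ^ 'n::finite \<Rightarrow> real) \<in> borel_measurable borel"
  unfolding gauss_blur_def[abs_def] by measurable

lemma lborel_integral_affine:
  fixes h :: "'a::euclidean_space \<Rightarrow> real"
  assumes [measurable]: "h \<in> borel_measurable borel" and c: "c > 0"
  shows "(\<integral>x. h x \<partial>lborel) = c ^ DIM('a) * (\<integral>x. h (t + c *\<^sub>R x) \<partial>lborel)"
proof -
  have "(\<integral>x. h x \<partial>lborel) = (\<integral>x. h x \<partial>density (distr lborel borel (\<lambda>x. t + c *\<^sub>R x)) (\<lambda>_. ennreal (c ^ DIM('a))))"
    using c by (subst lborel_affine[of c t]) auto
  also have "\<dots> = (\<integral>x. c ^ DIM('a) *\<^sub>R h x \<partial>distr lborel borel (\<lambda>x. t + c *\<^sub>R x))"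
    using c by (intro integral_density) auto
  also have "\<dots> = (\<integral>x. c ^ DIM('a) *\<^sub>R h (t + c *\<^sub>R x) \<partial>lborel)"
    by (intro integral_distr) auto
  finally show ?thesis
    by simp
qed

text \<open>Substituting \<open>w + z / k\<close> for \<open>z\<close> moves \<open>k\<close> from
  the weight into the argument of \<open>g\<close>, so that one dominating function serves all
  \<open>k\<close>.\<close>

lemma gauss_blur_rescale:
  fixes g :: "real ^ 'n::finite \<Rightarrow> real"
  assumes [measurable]: "g \<in> borel_measurable borel" and k: "k > 0"
  shows "k ^ CARD('n) * gauss_blur k g w = (\<integral>z. g (w + z /\<^sub>R k) * exp (- (norm z)\<^sup>2 / 2) \<partial>lborel)"
proof -
  have "gauss_blur k g w = (1 / k) ^ CARD('n) * (\<integral>z. g (w + (1 / k) *\<^sub>R z) * exp (- (norm (k *\<^sub>R (w + (1 / k) *\<^sub>R z - w)))\<^sup>2 / 2) \<partial>lborel)"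
    unfolding gauss_blur_def using k by (subst lborel_integral_affine[where c="1 / k" and t=w]) auto
  also have "(\<lambda>z. g (w + (1 / k) *\<^sub>R z) * exp (- (norm (k *\<^sub>R (w + (1 / k) *\<^sub>R z - w)))\<^sup>2 / 2))
      = (\<lambda>z. g (w + z /\<^sub>R k) * exp (- (norm z)\<^sup>2 / 2))"
  proof
    fix z
    have "k *\<^sub>R (w + (1 / k) *\<^sub>R z - w) = z"
      using k by simp
    then show "g (w + (1 / k) *\<^sub>R z) * exp (- (norm (k *\<^sub>R (w + (1 / k) *\<^sub>R z - w)))\<^sup>2 / 2)
      = g (w + z /\<^sub>R k) * exp (- (norm z)\<^sup>2 / 2)"
      by (simp only: inverse_eq_divide)
  qed
  finally have "gauss_blur k g w = (1 / k) ^ CARD('n) * (\<integral>z. g (w + z /\<^sub>R k) * exp (- (norm z)\<^sup>2 / 2) \<partial>lborel)" .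
  then show ?thesis
    using k by (simp add: power_divide)
qed

lemma gauss_blur_bound:
  fixes g :: "real ^ 'n::finite \<Rightarrow> real"
  assumes [measurable]: "g \<in> borel_measurable borel" and k: "k > 0" and B: "\<And>x. \<bar>g x\<bar> \<le> B"
  shows "\<bar>k ^ CARD('n) * gauss_blur k g w\<bar> \<le> B * (\<integral>z. exp (- (norm z)\<^sup>2 / 2) \<partial>(lborel :: (real^'n) measure))"
proof -
  have "\<bar>\<integral>z. g (w + z /\<^sub>R k) * exp (- (norm z)\<^sup>2 / 2) \<partial>lborel\<bar> \<le> (\<integral>z. B * exp (- (norm z)\<^sup>2 / 2) \<partial>(lborel :: (real^'n) measure))"
    (is "\<bar>integral\<^sup>L _ ?h\<bar> \<le> _")
  proof -
    have "\<bar>integral\<^sup>L lborel ?h\<bar> \<le> (\<integral>z. \<bar>?h z\<bar> \<partial>lborel)"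
      by (rule integral_abs_bound)
    also have "\<dots> \<le> (\<integral>z. B * exp (- (norm z)\<^sup>2 / 2) \<partial>(lborel :: (real^'n) measure))"
    proof (rule integral_mono_AE')
      show "integrable lborel (\<lambda>z::real^'n. B * exp (- (norm z)\<^sup>2 / 2))"
        by (intro integrable_mult_right gaussian_integral)
    qed (auto simp: abs_mult B order_trans[OF abs_ge_zero B] intro!: mult_right_mono)
    finally show ?thesis .
  qed
  then have "\<bar>k ^ CARD('n) * gauss_blur k g w\<bar> \<le> (\<integral>z. B * exp (- (norm z)\<^sup>2 / 2) \<partial>(lborel :: (real^'n) measure))"
    unfolding gauss_blur_rescale[OF assms(1) k] .
  then show ?thesis by simp
qed

text \<open>The scaled blur is an approximate identity: \<open>g (w + z / k)\<close> tends to
  \<open>g w\<close> by continuity, and \<open>B\<close> times the Gaussian dominates. The scale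
  \<open>Suc m\<close> keeps \<open>k\<close> positive from the start.\<close>

lemma gauss_blur_tendsto:
  fixes g :: "real ^ 'n::finite \<Rightarrow> real"
  assumes cont: "continuous_on UNIV g" and B: "\<And>x. \<bar>g x\<bar> \<le> B"
  shows "(\<lambda>m. real (Suc m) ^ CARD('n) * gauss_blur (real (Suc m)) g w)
    \<longlonglongrightarrow> g w * (\<integral>z. exp (- (norm z)\<^sup>2 / 2) \<partial>(lborel :: (real^'n) measure))"
proof -
  have m[measurable]: "g \<in> borel_measurable borel"
    by (rule borel_measurable_continuous_onI[OF cont])
  have "(\<lambda>m. \<integral>z. g (w + z /\<^sub>R real (Suc m)) * exp (- (norm z)\<^sup>2 / 2) \<partial>lborel)
    \<longlonglongrightarrow> (\<integral>z. g w * exp (- (norm z)\<^sup>2 / 2) \<partial>(lborel :: (real^'n) measure))"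
  proof (rule integral_dominated_convergence)
    show "integrable lborel (\<lambda>z::real^'n. B * exp (- (norm z)\<^sup>2 / 2))"
      by (intro integrable_mult_right gaussian_integral)
    show "AE z in lborel. (\<lambda>m. g (w + z /\<^sub>R real (Suc m)) * exp (- (norm z)\<^sup>2 / 2)) \<longlonglongrightarrow> g w * exp (- (norm z)\<^sup>2 / 2)"
    proof (intro AE_I2 tendsto_mult tendsto_const)
      fix z :: "real^'n"
      have "(\<lambda>m. w + z /\<^sub>R real (Suc m)) \<longlonglongrightarrow> w + 0 *\<^sub>R z"
        using LIMSEQ_inverse_real_of_nat by (intro tendsto_intros)
      then show "(\<lambda>m. g (w + z /\<^sub>R real (Suc m))) \<longlonglongrightarrow> g w"
        using cont by (intro isCont_tendsto_compose[of w g]) (auto simp: continuous_on_eq_continuous_at)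
    qed
  qed (auto simp: abs_mult B intro!: mult_right_mono)
  then show ?thesis
    by (subst gauss_blur_rescale[OF m]) auto
qed

lemma fourier_measurable [measurable]:
  assumes [measurable]: "g \<in> borel_measurable borel"
  shows "fourier (g :: real ^ 'n::finite \<Rightarrow> complex) \<in> borel_measurable borel"
  unfolding fourier_def[abs_def] by measurable

lemma norm_fourier_le:
  shows "norm (fourier g u) \<le> (\<integral>x. norm (g x) \<partial>lborel)"
proof -
  have "norm (fourier g u) \<le> (\<integral>x. norm (g x * exp (- 2 * of_real pi * \<i> * of_real (u \<bullet> x))) \<partial>lborel)"
    unfolding fourier_def by (rule integral_norm_bound)
  then show ?thesis by (simp add: norm_mult)
qed

text \<open>Fubini for a bounded integrand on a product of two probability measures. The sign of
  \<open>s\<close> is left free because the two variables of the quadratic form enter with opposite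
  signs.\<close>

lemma char_integral_swap:
  fixes M N :: "'a::euclidean_space measure" and H :: "'a \<Rightarrow> complex"
  assumes M: "prob_space M" "sets M = sets borel" and N: "prob_space N" "sets N = sets borel"
    and H[measurable]: "H \<in> borel_measurable borel" and B: "\<And>x. norm (H x) \<le> B"
  shows "(\<integral>y. \<integral>x. exp (\<i> * of_real (s * (y \<bullet> x))) * H x \<partial>N \<partial>M) =
    (\<integral>x. (\<integral>y. exp (\<i> * of_real (s * (y \<bullet> x))) \<partial>M) * H x \<partial>N)"
proof -
  interpret N: prob_space N by fact
  interpret M: prob_space M by fact
  interpret pair_prob_space N M ..
  note [measurable_cong] = M(2) N(2)
  have "integrable (N \<Otimes>\<^sub>M M) (\<lambda>(x, y). exp (\<i> * of_real (s * (y \<bullet> x))) * H x)"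
    by (rule P.integrable_const_bound[where B=B]) (auto simp: norm_mult B)
  from Fubini_integral[OF this] show ?thesis
    by simp
qed

lemma norm_char_integral_le:
  assumes "prob_space M"
  shows "norm (\<integral>y. exp (\<i> * of_real (s * (y \<bullet> x))) \<partial>M) \<le> 1"
proof -
  interpret prob_space M by fact
  have "norm (\<integral>y. exp (\<i> * of_real (s * (y \<bullet> x))) \<partial>M) \<le> (\<integral>y. norm (exp (\<i> * of_real (s * (y \<bullet> x)))) \<partial>M)"
    by (rule integral_norm_bound)
  then show ?thesis by (simp add: prob_space)
qed

section \<open>Positive definite matrix kernels\<close>

text \<open>\<open>fourier_pos\<close> includes frequency \<open>0\<close>; there it comes from
  hypothesis (i), because the subtracted rank one matrix is itself positive semidefinite.\<close>

locale pos_def_kernel =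
  fixes g :: "'m::finite \<Rightarrow> 'm \<Rightarrow> real ^ 'n::finite \<Rightarrow> real"
  assumes int: "\<And>i j. integrable lborel (g i j)"
    and cont: "\<And>i j. continuous_on UNIV (g i j)"
    and bounded: "\<And>i j. bounded (range (g i j))"
    and fourier_pos: "\<And>u (v :: 'm \<Rightarrow> complex).
      0 \<le> Re (\<Sum>i\<in>UNIV. \<Sum>j\<in>UNIV. cnj (v i) * fourier (\<lambda>x. of_real (g i j x)) u * v j)"
begin

lemma g_borel [measurable]: "g i j \<in> borel_measurable borel"
  by (rule borel_measurable_continuous_onI[OF cont])

text \<open>
  Blurring writes the kernel as an average of characters, so that the quadratic form becomes
  the expectation of \<open>v\<^sup>* ghat(u) v\<close> at a random frequency \<open>u\<close>; this avoids Fourier inversion and any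
  decay of the Fourier transform.
\<close>

lemma gauss_blur_form_nonneg:
  fixes \<alpha> :: "'a \<Rightarrow> (real ^ 'n) measure" and w :: "'a \<Rightarrow> real" and c :: "'a \<Rightarrow> 'm"
  assumes I: "finite I" and \<alpha>: "\<And>a. a \<in> I \<Longrightarrow> prob_space (\<alpha> a)" "\<And>a. a \<in> I \<Longrightarrow> sets (\<alpha> a) = sets borel"
  shows "0 \<le> (\<Sum>a\<in>I. \<Sum>b\<in>I. w a * w b * (\<integral>x. \<integral>y. gauss_blur k (g (c a) (c b)) (y - x) \<partial>\<alpha> b \<partial>\<alpha> a))"
    (is "0 \<le> ?S")
proof -
  obtain N :: "(real^'n) measure" where N: "prob_space N" "sets N = sets borel"
    and char: "\<And>z. (\<integral>x. exp (\<i> * of_real (z \<bullet> x)) \<partial>N) = of_real (exp (- (norm z)\<^sup>2 / 2))"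
    by (rule standard_gaussian_exists) blast
  interpret N: prob_space N by fact
  note [measurable_cong] = N(2)
  \<comment> \<open>\<open>A a\<close> is the characteristic function of \<open>\<alpha> a\<close>
    and \<open>F\<close> is the Fourier matrix of the kernel, both at the frequency given by the
    Gaussian sample \<open>x\<close>.\<close>
  define A where "A a x = (\<integral>y. exp (\<i> * of_real (- k * (y \<bullet> x))) \<partial>\<alpha> a)" for a x
  define F where "F i j x = fourier (\<lambda>z. complex_of_real (g i j z)) (- (k / (2 * pi)) *\<^sub>R x)" for i j x
  have A_meas: "A a \<in> borel_measurable borel" if "a \<in> I" for a
  proof -
    interpret prob_space "\<alpha> a" by (rule \<alpha>(1)[OF that])
    note [measurable_cong] = \<alpha>(2)[OF that]
    show ?thesis unfolding A_def[abs_def] by measurable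
  qed
  have F_meas [measurable]: "F i j \<in> borel_measurable borel" for i j
    unfolding F_def[abs_def] by measurable
  have A_le: "norm (A a x) \<le> 1" if "a \<in> I" for a x
    unfolding A_def by (rule norm_char_integral_le[OF \<alpha>(1)[OF that]])
  have F_le: "norm (F i j x) \<le> (\<integral>x. \<bar>g i j x\<bar> \<partial>lborel)" for i j x
    unfolding F_def by (rule order_trans[OF norm_fourier_le]) simp
  have cnj_A: "cnj (A a x) = (\<integral>y. exp (\<i> * of_real (k * (y \<bullet> x))) \<partial>\<alpha> a)" for a x
    unfolding A_def by (subst Bochner_Integration.integral_cnj[symmetric]) (simp add: exp_cnj)
  have FA_le: "norm (F i j x * A b x) \<le> (\<integral>x. \<bar>g i j x\<bar> \<partial>lborel)" if "b \<in> I" for i j b x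
    using mult_mono[OF F_le[of i j x] A_le[OF that, of x]] by (simp add: norm_mult)
  have AFA_le: "norm (cnj (A a x) * F i j x * A b x) \<le> (\<integral>x. \<bar>g i j x\<bar> \<partial>lborel)" if "a \<in> I" "b \<in> I" for i j a b x
    using mult_mono[OF A_le[OF that(1), of x] FA_le[OF that(2), of i j x]] by (simp add: norm_mult mult.assoc)
  \<comment> \<open>The blur at \<open>y - x\<close> averages a character in \<open>y\<close> times
    a character in \<open>x\<close>. Integrating out \<open>y\<close> yields \<open>A b\<close>, and
    integrating out \<open>x\<close> yields the conjugate of \<open>A a\<close>.\<close>
  have rep: "of_real (\<integral>x. \<integral>y. gauss_blur k (g i j) (y - x) \<partial>\<alpha> b \<partial>\<alpha> a) = (\<integral>x. cnj (A a x) * F i j x * A b x \<partial>N)"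
    if a: "a \<in> I" and b: "b \<in> I" for a b i j
  proof -
    note [measurable] = A_meas[OF a] A_meas[OF b]
    have "complex_of_real (\<integral>x. \<integral>y. gauss_blur k (g i j) (y - x) \<partial>\<alpha> b \<partial>\<alpha> a)
        = (\<integral>x. \<integral>y. of_real (gauss_blur k (g i j) (y - x)) \<partial>\<alpha> b \<partial>\<alpha> a)"
      by (simp only: integral_complex_of_real)
    also have "\<dots> = (\<integral>x. \<integral>y. \<integral>z. exp (\<i> * of_real (- k * (y \<bullet> z))) * (exp (\<i> * of_real (k * (x \<bullet> z))) * F i j z) \<partial>N \<partial>\<alpha> b \<partial>\<alpha> a)"
    proof (intro Bochner_Integration.integral_cong refl)
      fix x y
      have "complex_of_real (gauss_blur k (g i j) (y - x)) = (\<integral>z. exp (- (\<i> * of_real (k * ((y - x) \<bullet> z)))) * F i j z \<partial>N)"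
        unfolding gauss_blur_def F_def by (rule fourier_gaussian_weight[OF N char int])
      also have "\<dots> = (\<integral>z. exp (\<i> * of_real (- k * (y \<bullet> z))) * (exp (\<i> * of_real (k * (x \<bullet> z))) * F i j z) \<partial>N)"
        by (intro Bochner_Integration.integral_cong refl)
          (simp add: inner_diff_left ring_distribs exp_diff exp_minus divide_inverse)
      finally show "complex_of_real (gauss_blur k (g i j) (y - x)) = \<dots>" .
    qed
    also have "\<dots> = (\<integral>x. \<integral>z. A b z * (exp (\<i> * of_real (k * (x \<bullet> z))) * F i j z) \<partial>N \<partial>\<alpha> a)"
      unfolding A_def
      by (intro Bochner_Integration.integral_cong refl char_integral_swap[OF \<alpha>(1)[OF b] \<alpha>(2)[OF b] N, where B="\<integral>x. \<bar>g i j x\<bar> \<partial>lborel"])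
         (auto simp: norm_mult F_le)
    also have "\<dots> = (\<integral>x. \<integral>z. exp (\<i> * of_real (k * (x \<bullet> z))) * (F i j z * A b z) \<partial>N \<partial>\<alpha> a)"
      by (simp add: mult_ac)
    also have "\<dots> = (\<integral>z. cnj (A a z) * (F i j z * A b z) \<partial>N)"
      unfolding cnj_A
      by (rule char_integral_swap[OF \<alpha>(1)[OF a] \<alpha>(2)[OF a] N, where B="\<integral>x. \<bar>g i j x\<bar> \<partial>lborel"])
         (auto simp: FA_le b)
    finally show ?thesis
      by (simp add: mult.assoc)
  qed
  have intg: "integrable N (\<lambda>x. cnj (A a x) * F i j x * A b x)" if a: "a \<in> I" and b: "b \<in> I" for a b i j
  proof -
    note [measurable] = A_meas[OF a] A_meas[OF b]
    have [measurable]: "cnj \<in> borel_measurable borel"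
      by (intro borel_measurable_continuous_onI continuous_intros)
    show ?thesis
      by (rule N.integrable_const_bound[where B="\<integral>x. \<bar>g i j x\<bar> \<partial>lborel"]) (auto simp: AFA_le a b)
  qed
  let ?\<Phi> = "\<lambda>x. \<Sum>a\<in>I. \<Sum>b\<in>I. (of_real (w a) * cnj (A a x)) * F (c a) (c b) x * (of_real (w b) * A b x)"
  have \<Phi>_eq: "?\<Phi> = (\<lambda>x. \<Sum>a\<in>I. \<Sum>b\<in>I. of_real (w a * w b) * (cnj (A a x) * F (c a) (c b) x * A b x))"
    by (simp add: mult_ac)
  have int_\<Phi>: "integrable N ?\<Phi>"
    unfolding \<Phi>_eq by (intro Bochner_Integration.integrable_sum integrable_mult_right intg)
  have "(\<integral>x. ?\<Phi> x \<partial>N) = (\<Sum>a\<in>I. \<integral>x. (\<Sum>b\<in>I. of_real (w a * w b) * (cnj (A a x) * F (c a) (c b) x * A b x)) \<partial>N)"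
    unfolding \<Phi>_eq
    by (rule Bochner_Integration.integral_sum) (intro Bochner_Integration.integrable_sum integrable_mult_right intg)
  also have "\<dots> = (\<Sum>a\<in>I. \<Sum>b\<in>I. \<integral>x. of_real (w a * w b) * (cnj (A a x) * F (c a) (c b) x * A b x) \<partial>N)"
    by (intro sum.cong refl Bochner_Integration.integral_sum integrable_mult_right intg)
  also have "\<dots> = (\<Sum>a\<in>I. \<Sum>b\<in>I. of_real (w a * w b * (\<integral>x. \<integral>y. gauss_blur k (g (c a) (c b)) (y - x) \<partial>\<alpha> b \<partial>\<alpha> a)))"
    by (intro sum.cong refl) (simp only: integral_mult_right_zero rep of_real_mult)
  finally have "of_real ?S = (\<integral>x. ?\<Phi> x \<partial>N)"
    by (simp only: of_real_sum)
  from arg_cong[OF this, of Re] have "?S = Re (\<integral>x. ?\<Phi> x \<partial>N)"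
    by (simp only: Re_complex_of_real)
  also have "\<dots> = (\<integral>x. Re (?\<Phi> x) \<partial>N)"
    by (rule integral_Re[OF int_\<Phi>, symmetric])
  also have "\<dots> \<ge> 0"
  proof (rule Bochner_Integration.integral_nonneg)
    fix x
    \<comment> \<open>At a fixed frequency this is the sesquilinear form of the Fourier matrix at
      the vector whose entry \<open>i\<close> sums \<open>w a * A a x\<close> over the indices of
      type \<open>i\<close>.\<close>
    have "?\<Phi> x = (\<Sum>i\<in>UNIV. \<Sum>j\<in>UNIV. cnj (\<Sum>a\<in>{a\<in>I. c a = i}. of_real (w a) * A a x) * F i j x *
      (\<Sum>b\<in>{b\<in>I. c b = j}. of_real (w b) * A b x))"
      by (subst sum_bilinear_group[OF I, where F="\<lambda>i j. F i j x"]) simp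
    then show "0 \<le> Re (?\<Phi> x)"
      using fourier_pos[of "\<lambda>i. \<Sum>a\<in>{a\<in>I. c a = i}. of_real (w a) * A a x" "- (k / (2 * pi)) *\<^sub>R x"]
      by (simp only: F_def)
  qed
  finally show ?thesis .
qed

text \<open>Dominated convergence is applied twice: the uniform bound on the scaled blur dominates
  the inner integrand and, \<open>\<beta>\<close> having mass one, also the outer one.\<close>

lemma gauss_blur_double_integral_tendsto:
  assumes \<alpha>: "prob_space \<alpha>" "sets \<alpha> = sets borel" and \<beta>: "prob_space \<beta>" "sets \<beta> = sets borel"
  shows "(\<lambda>m. real (Suc m) ^ CARD('n) * (\<integral>x. \<integral>y. gauss_blur (real (Suc m)) (g i j) (y - x) \<partial>\<beta> \<partial>\<alpha>))
    \<longlonglongrightarrow> (\<integral>x. \<integral>y. g i j (y - x) \<partial>\<beta> \<partial>\<alpha>) * (\<integral>z. exp (- (norm z)\<^sup>2 / 2) \<partial>(lborel :: (real^'n) measure))"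
proof -
  interpret \<alpha>: prob_space \<alpha> by fact
  interpret \<beta>: prob_space \<beta> by fact
  note [measurable_cong] = \<alpha>(2) \<beta>(2)
  let ?Z = "\<integral>z. exp (- (norm z)\<^sup>2 / 2) \<partial>(lborel :: (real^'n) measure)"
  obtain B where B: "\<And>x. \<bar>g i j x\<bar> \<le> B"
    using bounded[of i j] by (auto simp: bounded_iff)
  let ?h = "\<lambda>m w. real (Suc m) ^ CARD('n) * gauss_blur (real (Suc m)) (g i j) w"
  have h_le: "norm (?h m w) \<le> B * ?Z" for m w
    using gauss_blur_bound[OF g_borel _ B, of "real (Suc m)" w] by simp
  have inner: "(\<lambda>m. \<integral>y. ?h m (y - x) \<partial>\<beta>) \<longlonglongrightarrow> (\<integral>y. g i j (y - x) * ?Z \<partial>\<beta>)" for x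
    by (rule integral_dominated_convergence[where w="\<lambda>_. B * ?Z"])
       (use h_le gauss_blur_tendsto[OF cont B] in \<open>auto simp del: of_nat_Suc\<close>)
  have inner_le: "norm (\<integral>y. ?h m (y - x) \<partial>\<beta>) \<le> B * ?Z" for m x
  proof -
    have "norm (\<integral>y. ?h m (y - x) \<partial>\<beta>) \<le> (\<integral>y. norm (?h m (y - x)) \<partial>\<beta>)"
      by (rule integral_norm_bound)
    also have "\<dots> \<le> (\<integral>y. B * ?Z \<partial>\<beta>)"
      by (rule integral_mono_AE') (use h_le order_trans[OF norm_ge_zero h_le] in \<open>auto simp del: of_nat_Suc\<close>)
    finally show ?thesis by (simp add: \<beta>.prob_space)
  qed
  have "(\<lambda>m. \<integral>x. \<integral>y. ?h m (y - x) \<partial>\<beta> \<partial>\<alpha>) \<longlonglongrightarrow> (\<integral>x. \<integral>y. g i j (y - x) * ?Z \<partial>\<beta> \<partial>\<alpha>)"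
    by (rule integral_dominated_convergence[where w="\<lambda>_. B * ?Z"])
       (use inner_le inner in \<open>auto simp del: of_nat_Suc integral_mult_right_zero\<close>)
  then show ?thesis
    by simp
qed

text \<open>Scaling by \<open>k ^ CARD('n)\<close> keeps the blurred forms nonnegative, and their
  limit is the form of \<open>g\<close> times the positive Gaussian integral. Arbitrary probability
  measures cover point masses and uniform measures at once.\<close>

theorem form_nonneg:
  fixes \<alpha> :: "'a \<Rightarrow> (real ^ 'n) measure" and w :: "'a \<Rightarrow> real" and c :: "'a \<Rightarrow> 'm"
  assumes I: "finite I" and \<alpha>: "\<And>a. a \<in> I \<Longrightarrow> prob_space (\<alpha> a)" "\<And>a. a \<in> I \<Longrightarrow> sets (\<alpha> a) = sets borel"
  shows "0 \<le> (\<Sum>a\<in>I. \<Sum>b\<in>I. w a * w b * (\<integral>x. \<integral>y. g (c a) (c b) (y - x) \<partial>\<alpha> b \<partial>\<alpha> a))" (is "0 \<le> ?S")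
proof -
  let ?Z = "\<integral>z. exp (- (norm z)\<^sup>2 / 2) \<partial>(lborel :: (real^'n) measure)"
  let ?T = "\<lambda>m. \<Sum>a\<in>I. \<Sum>b\<in>I. w a * w b * (\<integral>x. \<integral>y. gauss_blur (real (Suc m)) (g (c a) (c b)) (y - x) \<partial>\<alpha> b \<partial>\<alpha> a)"
  have "(\<lambda>m. \<Sum>a\<in>I. \<Sum>b\<in>I. w a * w b * (real (Suc m) ^ CARD('n) * (\<integral>x. \<integral>y. gauss_blur (real (Suc m)) (g (c a) (c b)) (y - x) \<partial>\<alpha> b \<partial>\<alpha> a)))
    \<longlonglongrightarrow> (\<Sum>a\<in>I. \<Sum>b\<in>I. w a * w b * ((\<integral>x. \<integral>y. g (c a) (c b) (y - x) \<partial>\<alpha> b \<partial>\<alpha> a) * ?Z))"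
    by (intro tendsto_sum tendsto_mult[OF tendsto_const] gauss_blur_double_integral_tendsto \<alpha>)
  then have "(\<lambda>m. real (Suc m) ^ CARD('n) * ?T m) \<longlonglongrightarrow> ?S * ?Z"
    by (simp only: sum_distrib_left sum_distrib_right mult_ac)
  then have "0 \<le> ?S * ?Z"
    by (rule LIMSEQ_le_const) (use gauss_blur_form_nonneg[OF I \<alpha>] in \<open>auto intro!: exI[of _ 0] mult_nonneg_nonneg\<close>)
  with gaussian_integral(2)[where 'a="real^'n"] show ?thesis
    by (simp add: zero_le_mult_iff)
qed

end

section \<open>Tails of integrable functions and Schwartz functions\<close>

text \<open>The sign \<open>\<epsilon>\<close> treats translations and reflections together: the
  kernel need not be even, so both \<open>g (y - t)\<close> and \<open>g (t - y)\<close> have to be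
  integrated.\<close>

lemma lborel_integral_reflect:
  fixes h :: "'a::euclidean_space \<Rightarrow> real"
  assumes [measurable]: "h \<in> borel_measurable borel" and \<epsilon>: "\<bar>\<epsilon>\<bar> = 1"
  shows "(\<integral>x. h x \<partial>lborel) = (\<integral>x. h (t + \<epsilon> *\<^sub>R x) \<partial>lborel)"
proof -
  have "\<epsilon> \<noteq> 0"
    using \<epsilon> by auto
  have "(\<integral>x. h x \<partial>lborel) = (\<integral>x. h x \<partial>distr lborel borel (\<lambda>x. t + \<epsilon> *\<^sub>R x))"
    by (subst lborel_affine[OF \<open>\<epsilon> \<noteq> 0\<close>, of t]) (simp add: \<epsilon> density_1)
  then show ?thesis
    by (simp add: integral_distr)
qed

definition tail :: "('a::euclidean_space \<Rightarrow> real) \<Rightarrow> real \<Rightarrow> real" where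
  "tail h L = (\<integral>x. \<bar>h x\<bar> * indicator {x. L \<le> norm x} x \<partial>lborel)"

lemma tail_tendsto_0:
  assumes h: "integrable lborel h"
  shows "((\<lambda>L. tail h L) \<longlongrightarrow> 0) at_top"
proof -
  note [measurable] = borel_measurable_integrable[OF h]
  have "((\<lambda>L. tail h L) \<longlongrightarrow> (\<integral>x. 0 \<partial>(lborel :: 'a measure))) at_top"
    unfolding tail_def
  proof (rule integral_dominated_convergence_at_top)
    show "integrable lborel (\<lambda>x. \<bar>h x\<bar>)" using h by simp
    show "\<forall>\<^sub>F L in at_top. AE x in lborel. norm (\<bar>h x\<bar> * indicator {x. L \<le> norm x} x) \<le> \<bar>h x\<bar>"
      by (auto simp: abs_mult indicator_def)
    show "AE x in lborel. ((\<lambda>L. \<bar>h x\<bar> * indicator {x. L \<le> norm x} x) \<longlongrightarrow> 0) at_top"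
    proof (intro AE_I2)
      fix x :: 'a
      show "((\<lambda>L. \<bar>h x\<bar> * indicator {x. L \<le> norm x} x) \<longlongrightarrow> 0) at_top"
        by (rule tendsto_eventually)
           (use eventually_gt_at_top[of "norm x"] in \<open>eventually_elim, auto\<close>)
    qed
  qed measurable
  then show ?thesis by simp
qed

lemma tail_nonneg: "0 \<le> tail h L"
  unfolding tail_def by (rule Bochner_Integration.integral_nonneg) auto

text \<open>After \<open>t\<close> is moved to the origin, the integrands differ only where the
  point falls outside \<open>B\<close>, hence at norm at least \<open>L\<close>. At
  \<open>L = 0\<close> the inclusion is vacuous and the error is the full L1 norm.\<close>

lemma restricted_integral_close:
  fixes h :: "'a::euclidean_space \<Rightarrow> real"
  assumes h: "integrable lborel h" and [measurable]: "h \<in> borel_measurable borel" "B \<in> sets borel"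
    and \<epsilon>: "\<bar>\<epsilon>\<bar> = 1" and B: "ball t L \<subseteq> B"
  shows "\<bar>(\<integral>y. h (\<epsilon> *\<^sub>R (y - t)) * indicator B y \<partial>lborel) - (\<integral>z. h z \<partial>lborel)\<bar> \<le> tail h L"
proof -
  have \<epsilon>2: "\<epsilon> * \<epsilon> = 1"
    using \<epsilon> by (auto simp: abs_if split: if_splits)
  have "(\<integral>y. h (\<epsilon> *\<^sub>R (y - t)) * indicator B y \<partial>lborel) = (\<integral>z. h z * indicator B (t + \<epsilon> *\<^sub>R z) \<partial>lborel)"
    by (subst lborel_integral_reflect[OF _ \<epsilon>, of _ t]) (simp_all add: \<epsilon>2)
  moreover have int: "integrable lborel (\<lambda>z. h z * indicator B (t + \<epsilon> *\<^sub>R z))"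
    by (rule Bochner_Integration.integrable_bound[OF h]) (auto simp: indicator_def)
  ultimately have "(\<integral>y. h (\<epsilon> *\<^sub>R (y - t)) * indicator B y \<partial>lborel) - (\<integral>z. h z \<partial>lborel)
    = (\<integral>z. h z * indicator B (t + \<epsilon> *\<^sub>R z) - h z \<partial>lborel)"
    using h by simp
  moreover have "\<bar>\<integral>z. h z * indicator B (t + \<epsilon> *\<^sub>R z) - h z \<partial>lborel\<bar> \<le> (\<integral>z. \<bar>h z * indicator B (t + \<epsilon> *\<^sub>R z) - h z\<bar> \<partial>lborel)"
    by (rule integral_abs_bound)
  moreover have "\<dots> \<le> tail h L"
    unfolding tail_def
  proof (rule integral_mono)
    show "integrable lborel (\<lambda>z. \<bar>h z * indicator B (t + \<epsilon> *\<^sub>R z) - h z\<bar>)"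
      using int h by simp
    show "integrable lborel (\<lambda>x. \<bar>h x\<bar> * indicator {x. L \<le> norm x} x)"
      by (rule Bochner_Integration.integrable_bound[OF h]) (auto simp: indicator_def)
    show "\<bar>h z * indicator B (t + \<epsilon> *\<^sub>R z) - h z\<bar> \<le> \<bar>h z\<bar> * indicator {x. L \<le> norm x} z" for z
    proof (cases "L \<le> norm z")
      case False
      then have "t + \<epsilon> *\<^sub>R z \<in> B"
        using B \<epsilon> by (auto simp: dist_norm)
      with False show ?thesis by simp
    qed (auto simp: indicator_def)
  qed
  ultimately show ?thesis by linarith
qed

lemma integral_uniform_measure_lborel:
  fixes h :: "'a::euclidean_space \<Rightarrow> real"
  assumes [measurable]: "h \<in> borel_measurable borel" "B \<in> sets borel"
    and B: "emeasure lborel B \<noteq> \<infinity>" "measure lborel B > 0"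
  shows "(\<integral>x. h x \<partial>uniform_measure lborel B) = (\<integral>x. h x * indicator B x \<partial>lborel) / measure lborel B"
proof -
  have "uniform_measure lborel B = density lborel (\<lambda>x. ennreal (indicator B x / measure lborel B))"
    unfolding uniform_measure_def using B
    by (intro density_cong) (auto simp: indicator_def emeasure_eq_ennreal_measure divide_ennreal[symmetric] simp del: divide_ennreal)
  then have "(\<integral>x. h x \<partial>uniform_measure lborel B) = (\<integral>x. (indicator B x / measure lborel B) *\<^sub>R h x \<partial>lborel)"
    using B(2) by (simp add: integral_density)
  then show ?thesis
    by (simp add: mult.commute)
qed

lemma unit_ball_vol_nonzero [simp]: "unit_ball_vol (real n) \<noteq> 0"
  using unit_ball_vol_pos[of "real n"] by linarith

lemma ball_subset_ball_add:
  assumes "x \<in> ball p \<rho>"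
  shows "ball x L \<subseteq> ball p (\<rho> + L)"
proof
  fix y assume "y \<in> ball x L"
  with assms dist_triangle[of p y x] show "y \<in> ball p (\<rho> + L)" by simp
qed

section \<open>Integrability of Schwartz functions\<close>

lemma integrable_inverse_square_prod:
  "integrable lborel (\<lambda>x::'a::euclidean_space. \<Prod>b\<in>Basis. inverse (1 + (x \<bullet> b)\<^sup>2))"
  using integrable_inverse_1_plus_square
  by (intro integral_prod_Basis(1)) (simp add: set_integrable_def)

context
  fixes g :: "real ^ 'n::finite \<Rightarrow> real"
  assumes schwartz: "schwartz g"
begin

lemma schwartz_bounded_moment: "bounded (range (\<lambda>x. (\<Prod>k\<in>UNIV. (x $ k) ^ \<alpha> k) * g x))"
  using schwartz[unfolded schwartz_def, THEN conjunct2, rule_format, of \<alpha> "[]"]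
  by (simp add: iter_partial_deriv_def)

lemma schwartz_bounded: "bounded (range g)"
  using schwartz_bounded_moment[of "\<lambda>_. 0"] by simp

lemma schwartz_continuous: "continuous_on UNIV g"
proof -
  have "iter_partial_deriv [] g differentiable_on UNIV"
    using schwartz unfolding schwartz_def smooth_def by blast
  then show ?thesis
    by (intro differentiable_imp_continuous_on) (simp add: iter_partial_deriv_def)
qed

text \<open>Expanding one factor \<open>1 + (x $ j)^2\<close> gives the same expression for
  \<open>\<alpha>\<close> and for \<open>\<alpha>\<close> raised by two at \<open>j\<close>, so the
  induction keeps \<open>\<alpha>\<close> general.\<close>

lemma schwartz_bounded_square_weight:
  assumes "finite S"
  shows "bounded (range (\<lambda>x. (\<Prod>k\<in>S. 1 + (x $ k)\<^sup>2) * ((\<Prod>k\<in>UNIV. (x $ k) ^ \<alpha> k) * g x)))"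
  using assms
proof (induction S arbitrary: \<alpha>)
  case empty
  then show ?case using schwartz_bounded_moment[of \<alpha>] by simp
next
  case (insert j S)
  let ?\<beta> = "\<alpha>(j := \<alpha> j + 2)"
  have "(\<Prod>k\<in>UNIV. (x $ k) ^ ?\<beta> k) = (x $ j)\<^sup>2 * (\<Prod>k\<in>UNIV. (x $ k) ^ \<alpha> k)" for x :: "real^'n"
  proof -
    have "(\<Prod>k\<in>UNIV. (x $ k) ^ ?\<beta> k) = (\<Prod>k\<in>UNIV. (if k = j then (x $ j)\<^sup>2 else 1) * (x $ k) ^ \<alpha> k)"
      by (intro prod.cong) (auto simp: power_add power2_eq_square mult.commute)
    then show ?thesis
      by (simp add: prod.distrib)
  qed
  then have eq: "(\<lambda>x. (\<Prod>k\<in>insert j S. 1 + (x $ k)\<^sup>2) * ((\<Prod>k\<in>UNIV. (x $ k) ^ \<alpha> k) * g x)) =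
    (\<lambda>x. (\<Prod>k\<in>S. 1 + (x $ k)\<^sup>2) * ((\<Prod>k\<in>UNIV. (x $ k) ^ \<alpha> k) * g x)
      + (\<Prod>k\<in>S. 1 + (x $ k)\<^sup>2) * ((\<Prod>k\<in>UNIV. (x $ k) ^ ?\<beta> k) * g x))"
    using insert.hyps by (auto simp: algebra_simps)
  show ?case
    unfolding eq by (rule bounded_plus_comp[OF insert.IH[of \<alpha>] insert.IH[of ?\<beta>]])
qed

text \<open>Boundedness against the product of all \<open>1 + (x $ k)^2\<close> dominates
  \<open>g\<close> by a multiple of a product of the integrable one-variable functions
  \<open>1 / (1 + t^2)\<close>.\<close>

lemma schwartz_integrable: "integrable lborel g"
proof -
  obtain B where B: "\<And>x. \<bar>(\<Prod>k\<in>UNIV. 1 + (x $ k)\<^sup>2) * g x\<bar> \<le> B"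
    using schwartz_bounded_square_weight[of UNIV "\<lambda>_. 0"] by (auto simp: bounded_iff)
  have eq: "(\<Prod>b\<in>Basis. inverse (1 + (x \<bullet> b)\<^sup>2)) = (\<Prod>k\<in>UNIV. inverse (1 + (x $ k)\<^sup>2))" for x :: "real^'n"
  proof -
    have "(\<Prod>b\<in>Basis. inverse (1 + (x \<bullet> b)\<^sup>2)) = (\<Prod>b\<in>(\<lambda>k. axis k (1::real)) ` (UNIV :: 'n set). inverse (1 + (x \<bullet> b)\<^sup>2))"
      by (intro prod.cong refl) (auto simp: Basis_vec_def)
    also have "\<dots> = (\<Prod>k\<in>UNIV. inverse (1 + (x $ k)\<^sup>2))"
      by (subst prod.reindex) (auto simp: inj_on_def axis_eq_axis cart_eq_inner_axis)
    finally show ?thesis .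
  qed
  have int: "integrable lborel (\<lambda>x::real^'n. B * (\<Prod>k\<in>UNIV. inverse (1 + (x $ k)\<^sup>2)))"
    using integrable_inverse_square_prod[where 'a="real^'n"] unfolding eq by (rule integrable_mult_right)
  show ?thesis
  proof (rule Bochner_Integration.integrable_bound[OF int])
    show "g \<in> borel_measurable lborel"
      using borel_measurable_continuous_onI[OF schwartz_continuous] by simp
    show "AE x in lborel. norm (g x) \<le> norm (B * (\<Prod>k\<in>UNIV. inverse (1 + (x $ k)\<^sup>2)))"
    proof (intro AE_I2)
      fix x :: "real^'n"
      have pos: "(\<Prod>k\<in>UNIV. 1 + (x $ k)\<^sup>2) > 0"
        by (intro prod_pos) (auto simp: add_pos_nonneg)
      then have "\<bar>g x\<bar> \<le> B * inverse (\<Prod>k\<in>UNIV. 1 + (x $ k)\<^sup>2)"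
        using B[of x] by (simp add: abs_mult field_simps)
      then show "norm (g x) \<le> norm (B * (\<Prod>k\<in>UNIV. inverse (1 + (x $ k)\<^sup>2)))"
        by (simp add: prod_inversef[symmetric])
    qed
  qed
qed

end

section \<open>Comparing point masses with the uniform measure on a ball\<close>

context pos_def_kernel
begin

text \<open>This is the Fourier transform of \<open>g i j\<close> at frequency \<open>0\<close>, as
  a real number.\<close>

definition mass :: "'m \<Rightarrow> 'm \<Rightarrow> real" where
  "mass i j = (\<integral>x. g i j x \<partial>lborel)"

text \<open>At \<open>L = 0\<close> this is the sum of the \<open>L\<^sup>1\<close> norms.\<close>

definition max_tail :: "real \<Rightarrow> real" where
  "max_tail L = (\<Sum>i\<in>UNIV. \<Sum>j\<in>UNIV. tail (g i j) L)"

lemma tail_le_max_tail: "tail (g i j) L \<le> max_tail L"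
proof -
  have "tail (g i j) L \<le> (\<Sum>j\<in>UNIV. tail (g i j) L)"
    by (rule member_le_sum) (auto simp: tail_nonneg)
  also have "\<dots> \<le> max_tail L"
    unfolding max_tail_def by (rule member_le_sum[of i]) (auto simp: tail_nonneg sum_nonneg)
  finally show ?thesis .
qed

lemma max_tail_nonneg: "0 \<le> max_tail L"
  unfolding max_tail_def by (intro sum_nonneg tail_nonneg)

lemma max_tail_tendsto_0: "(max_tail \<longlongrightarrow> 0) at_top"
proof -
  have "((\<lambda>L. \<Sum>i\<in>UNIV. \<Sum>j\<in>UNIV. tail (g i j) L) \<longlongrightarrow> (\<Sum>i\<in>(UNIV::'m set). \<Sum>j\<in>(UNIV::'m set). 0)) at_top"
    by (intro tendsto_sum tail_tendsto_0 int)
  then show ?thesis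
    by (simp add: max_tail_def[abs_def])
qed

text \<open>The quadratic form of a single unit point mass is the diagonal value at the
  origin.\<close>

lemma diagonal_nonneg: "0 \<le> g i i 0"
  using form_nonneg[of "{()}" "\<lambda>_. return borel 0" "\<lambda>_. 1" "\<lambda>_. i"]
  by (simp add: prob_space_return integral_return)

text \<open>A ball containing \<open>ball t L\<close> misses only the tail beyond \<open>L\<close>
  of the kernel centred at \<open>t\<close>.\<close>

lemma uniform_ball_average:
  fixes t :: "real^'n"
  assumes R: "R > 0" and sub: "ball t L \<subseteq> ball p R"
  shows "\<bar>(\<integral>y. g i j (y - t) \<partial>uniform_measure lborel (ball p R)) - mass i j / vol (ball p R)\<bar>
      \<le> max_tail L / vol (ball p R)"
    and "\<bar>(\<integral>y. g i j (t - y) \<partial>uniform_measure lborel (ball p R)) - mass i j / vol (ball p R)\<bar>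
      \<le> max_tail L / vol (ball p R)"
proof -
  let ?b = "vol (ball p R)"
  have b: "?b > 0" using R by (simp add: content_ball)
  have *: "\<bar>(\<integral>y. g i j (\<epsilon> *\<^sub>R (y - t)) \<partial>uniform_measure lborel (ball p R)) - mass i j / ?b\<bar> \<le> max_tail L / ?b"
    if \<epsilon>: "\<bar>\<epsilon>\<bar> = 1" for \<epsilon>
  proof -
    have "\<bar>(\<integral>y. g i j (\<epsilon> *\<^sub>R (y - t)) * indicator (ball p R) y \<partial>lborel) - mass i j\<bar> \<le> max_tail L"
      unfolding mass_def
      by (rule order_trans[OF restricted_integral_close[OF int g_borel _ \<epsilon> sub] tail_le_max_tail]) simp
    then have "\<bar>((\<integral>y. g i j (\<epsilon> *\<^sub>R (y - t)) * indicator (ball p R) y \<partial>lborel) - mass i j) / ?b\<bar> \<le> max_tail L / ?b"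
      using b by (simp add: abs_divide divide_right_mono)
    then show ?thesis
      using b R by (subst integral_uniform_measure_lborel) (auto simp: diff_divide_distrib emeasure_ball)
  qed
  from *[of 1] *[of "-1"] show
    "\<bar>(\<integral>y. g i j (y - t) \<partial>uniform_measure lborel (ball p R)) - mass i j / ?b\<bar> \<le> max_tail L / ?b"
    "\<bar>(\<integral>y. g i j (t - y) \<partial>uniform_measure lborel (ball p R)) - mass i j / ?b\<bar> \<le> max_tail L / ?b"
    by simp_all
qed

text \<open>Points of the concentric ball of radius \<open>\<rho>\<close> keep distance
  \<open>L\<close> from the boundary, so \<open>max_tail L\<close> covers them. The remaining shell
  has relative volume \<open>1 - (\<rho> / (\<rho> + L)) ^ CARD('n)\<close>, and there the crude
  error \<open>max_tail 0\<close> is affordable.\<close>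

lemma uniform_ball_double_average:
  fixes p :: "real^'n"
  assumes \<rho>: "\<rho> > 0" and L: "L > 0"
  defines "U \<equiv> uniform_measure lborel (ball p (\<rho> + L))"
  shows "(\<integral>x. \<integral>y. g i j (y - x) \<partial>U \<partial>U)
    \<le> (mass i j + max_tail L + max_tail 0 * (1 - (\<rho> / (\<rho> + L)) ^ CARD('n))) / vol (ball p (\<rho> + L))"
proof -
  let ?b = "vol (ball p (\<rho> + L))"
  have R: "\<rho> + L > 0" using \<rho> L by simp
  have b: "?b > 0" using R by (simp add: content_ball)
  have em: "emeasure lborel (ball p (\<rho> + L)) \<noteq> 0" "emeasure lborel (ball p (\<rho> + L)) \<noteq> \<infinity>"
    using R by (auto simp: emeasure_ball)
  interpret U: prob_space U
    unfolding U_def by (rule prob_space_uniform_measure[OF em])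
  have sets_U [measurable_cong]: "sets U = sets borel"
    by (simp add: U_def)
  have U_ball: "measure U (ball p \<rho>) = (\<rho> / (\<rho> + L)) ^ CARD('n)"
  proof -
    have "ball p (\<rho> + L) \<inter> ball p \<rho> = ball p \<rho>" using L by auto
    then show ?thesis
      using em \<rho> R by (simp add: U_def content_ball power_divide)
  qed
  obtain B where B: "\<And>x. \<bar>g i j x\<bar> \<le> B"
    using bounded[of i j] by (auto simp: bounded_iff)
  let ?\<phi> = "\<lambda>x. \<integral>y. g i j (y - x) \<partial>U"
  let ?\<psi> = "\<lambda>x. (mass i j + max_tail L + max_tail 0 * (1 - indicator (ball p \<rho>) x)) / ?b"
  have ind: "integrable U (indicator (ball p \<rho>) :: _ \<Rightarrow> real)"
    by (rule U.integrable_const_bound[where B=1]) (auto intro!: borel_measurable_indicator simp: sets_U)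
  have "(\<integral>x. ?\<phi> x \<partial>U) \<le> (\<integral>x. ?\<psi> x \<partial>U)"
  proof (rule integral_mono)
    show "integrable U ?\<phi>"
    proof (rule U.integrable_const_bound[where B=B])
      have "\<bar>?\<phi> x\<bar> \<le> (\<integral>y. B \<partial>U)" for x
        by (rule order_trans[OF integral_abs_bound], rule integral_mono_AE')
           (use B order_trans[OF abs_ge_zero B] in auto)
      then show "AE x in U. norm (?\<phi> x) \<le> B"
        by (simp add: U.prob_space)
    qed measurable
    show "integrable U ?\<psi>"
      by (intro integrable_divide Bochner_Integration.integrable_add Bochner_Integration.integrable_diff integrable_mult_right)
         (auto simp: ind)
    show "?\<phi> x \<le> ?\<psi> x" for x
    proof (cases "x \<in> ball p \<rho>")
      case True
      have "ball x L \<subseteq> ball p (\<rho> + L)"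
        using True by (rule ball_subset_ball_add)
      from uniform_ball_average(1)[OF R this, where i=i and j=j] True show ?thesis
        by (simp add: U_def add_divide_distrib abs_le_iff)
    next
      case False
      \<comment> \<open>With \<open>L = 0\<close> the required inclusion concerns the empty ball
        \<open>ball x 0\<close>, so it holds at every \<open>x\<close>.\<close>
      from uniform_ball_average(1)[OF R, of x 0 p, where i=i and j=j] have "?\<phi> x \<le> (mass i j + max_tail 0) / ?b"
        by (simp add: U_def add_divide_distrib abs_le_iff)
      also have "\<dots> \<le> ?\<psi> x"
        using False b max_tail_nonneg[of L] by (simp add: divide_right_mono)
      finally show ?thesis .
    qed
  qed
  also have "(\<integral>x. ?\<psi> x \<partial>U) = (mass i j + max_tail L + max_tail 0 * (1 - (\<rho> / (\<rho> + L)) ^ CARD('n))) / ?b"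
    by (simp add: U.prob_space U_ball sets_U ind)
  finally show ?thesis .
qed

text \<open>
  The quadratic form is evaluated at the signed measure with mass \<open>s a\<close> at \<open>t a\<close>, minus the same
  mass spread uniformly over \<open>ball p (\<rho> + L)\<close>.
\<close>

lemma point_form_lower_bound:
  fixes t :: "'a \<Rightarrow> real^'n" and c :: "'a \<Rightarrow> 'm" and s :: "'a \<Rightarrow> real"
  assumes T: "finite T" and s: "\<And>a. a \<in> T \<Longrightarrow> 0 \<le> s a" and t: "\<And>a. a \<in> T \<Longrightarrow> t a \<in> ball p \<rho>"
    and \<rho>: "\<rho> > 0" and L: "L > 0"
  shows "(\<Sum>a\<in>T. \<Sum>b\<in>T. s a * mass (c a) (c b) * s b) / vol (ball p (\<rho> + L))
    - (\<Sum>a\<in>T. s a)\<^sup>2 * ((3 * max_tail L + max_tail 0 * (1 - (\<rho> / (\<rho> + L)) ^ CARD('n))) / vol (ball p (\<rho> + L)))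
    \<le> (\<Sum>a\<in>T. \<Sum>b\<in>T. s a * s b * g (c a) (c b) (t b - t a))"
proof -
  let ?b = "vol (ball p (\<rho> + L))"
  let ?E = "(3 * max_tail L + max_tail 0 * (1 - (\<rho> / (\<rho> + L)) ^ CARD('n))) / ?b"
  define U where "U = uniform_measure lborel (ball p (\<rho> + L))"
  have R: "\<rho> + L > 0" using \<rho> L by simp
  have b: "?b > 0" using R by (simp add: content_ball)
  have "prob_space U"
    unfolding U_def using R by (intro prob_space_uniform_measure) (auto simp: emeasure_ball)
  then interpret U: prob_space U .
  have sets_U [measurable_cong]: "sets U = sets borel"
    by (simp add: U_def)
  \<comment> \<open>Left indices carry the point masses with weight \<open>s a\<close>, right
    indices the uniform measure with weight \<open>- s a\<close>; both keep the type of their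
    copy.\<close>
  define \<alpha> where "\<alpha> = case_sum (\<lambda>a. return borel (t a)) (\<lambda>_::'a. U)"
  define w where "w = case_sum s (\<lambda>a. - s a)"
  define d where "d = case_sum c c"
  let ?P = "\<lambda>a b. g (c a) (c b) (t b - t a)"
  let ?X = "\<lambda>a b. \<integral>y. g (c a) (c b) (y - t a) \<partial>U"
  let ?Y = "\<lambda>a b. \<integral>x. g (c a) (c b) (t b - x) \<partial>U"
  let ?D = "\<lambda>a b. \<integral>x. \<integral>y. g (c a) (c b) (y - x) \<partial>U \<partial>U"
  have "0 \<le> (\<Sum>a\<in>T <+> T. \<Sum>b\<in>T <+> T. w a * w b * (\<integral>x. \<integral>y. g (d a) (d b) (y - x) \<partial>\<alpha> b \<partial>\<alpha> a))"
    using T U.prob_space_axioms by (intro form_nonneg) (auto simp: \<alpha>_def sets_U prob_space_return split: sum.split)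
  also have "\<dots> = (\<Sum>a\<in>T. \<Sum>b\<in>T. s a * s b * (?P a b - ?X a b - ?Y a b + ?D a b))"
    using T by (simp add: sum.Plus \<alpha>_def w_def d_def integral_return sum.distrib sum_subtractf ring_distribs sum_negf)
  also have "\<dots> \<le> (\<Sum>a\<in>T. \<Sum>b\<in>T. s a * s b * (?P a b - mass (c a) (c b) / ?b + ?E))"
  proof (intro sum_mono mult_left_mono)
    fix a b assume ab: "a \<in> T" "b \<in> T"
    have sub: "ball (t a) L \<subseteq> ball p (\<rho> + L)" if "a \<in> T" for a
      using t[OF that] by (rule ball_subset_ball_add)
    \<comment> \<open>The two mixed terms enter negatively and are bounded below; the doubly uniform
      term enters positively and is bounded above. Each costs one \<open>max_tail L\<close>, hence
      the factor 3, and the three \<open>mass\<close> terms add up to a single negative one.\<close>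
    have "?X a b \<ge> mass (c a) (c b) / ?b - max_tail L / ?b"
      using uniform_ball_average(1)[OF R sub[OF ab(1)], where i="c a" and j="c b"] by (simp add: U_def abs_le_iff)
    moreover have "?Y a b \<ge> mass (c a) (c b) / ?b - max_tail L / ?b"
      using uniform_ball_average(2)[OF R sub[OF ab(2)], where i="c a" and j="c b"] by (simp add: U_def abs_le_iff)
    moreover have "?D a b \<le> mass (c a) (c b) / ?b + max_tail L / ?b + max_tail 0 * (1 - (\<rho> / (\<rho> + L)) ^ CARD('n)) / ?b"
      using uniform_ball_double_average[OF \<rho> L, where i="c a" and j="c b" and p=p] unfolding U_def by (simp only: add_divide_distrib)
    moreover have "?E = 3 * (max_tail L / ?b) + max_tail 0 * (1 - (\<rho> / (\<rho> + L)) ^ CARD('n)) / ?b"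
      by (simp add: add_divide_distrib)
    ultimately show "?P a b - ?X a b - ?Y a b + ?D a b \<le> ?P a b - mass (c a) (c b) / ?b + ?E"
      by linarith
    show "0 \<le> s a * s b" using s ab by simp
  qed
  also have "\<dots> = (\<Sum>a\<in>T. \<Sum>b\<in>T. s a * s b * ?P a b) - (\<Sum>a\<in>T. \<Sum>b\<in>T. s a * mass (c a) (c b) * s b) / ?b + (\<Sum>a\<in>T. s a)\<^sup>2 * ?E"
  proof -
    have "(\<Sum>a\<in>T. s a)\<^sup>2 * e = (\<Sum>a\<in>T. \<Sum>b\<in>T. s a * s b * e)" for e
      unfolding power2_eq_square sum_product by (simp add: sum_distrib_right)
    then have "(\<Sum>a\<in>T. \<Sum>b\<in>T. s a * s b * (?P a b - mass (c a) (c b) / ?b + e)) =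
      (\<Sum>a\<in>T. \<Sum>b\<in>T. s a * s b * ?P a b) - (\<Sum>a\<in>T. \<Sum>b\<in>T. s a * mass (c a) (c b) * s b) / ?b + (\<Sum>a\<in>T. s a)\<^sup>2 * e" for e
      by (simp add: sum.distrib sum_subtractf ring_distribs sum_divide_distrib mult_ac)
    then show ?thesis .
  qed
  finally show ?thesis by simp
qed

text \<open>Let \<open>V\<close> be the total volume. Each weight is at least
  \<open>sqrt \<mu>\<close>, so the squared total weight is at most \<open>V^2 / \<mu>\<close> and
  the boundary error at most \<open>\<eta> V^2\<close> over the ball volume. With the bound
  \<open>M V\<close> on the point masses, one factor \<open>V\<close> cancels.\<close>

lemma packing_volume_bound:
  fixes t :: "'a \<Rightarrow> real^'n" and c :: "'a \<Rightarrow> 'm" and v :: "'m \<Rightarrow> real"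
  assumes T: "finite T" and t: "\<And>a. a \<in> T \<Longrightarrow> t a \<in> ball p \<rho>" and \<rho>: "\<rho> > 0" and L: "L > 0"
    and \<mu>: "\<mu> > 0" "\<And>i. \<mu> \<le> v i"
    and mass_ge: "\<And>x :: 'm \<Rightarrow> real. (\<Sum>i\<in>UNIV. x i * sqrt (v i))\<^sup>2 \<le> (\<Sum>i\<in>UNIV. \<Sum>j\<in>UNIV. x i * mass i j * x j)"
    and nonpos: "\<And>a b. a \<in> T \<Longrightarrow> b \<in> T \<Longrightarrow> a \<noteq> b \<Longrightarrow> g (c a) (c b) (t b - t a) \<le> 0"
    and M: "\<And>i. g i i 0 \<le> M"
  defines "\<eta> \<equiv> (3 * max_tail L + max_tail 0 * (1 - (\<rho> / (\<rho> + L)) ^ CARD('n))) / \<mu>"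
  assumes \<eta>: "\<eta> < 1"
  shows "(\<Sum>a\<in>T. v (c a)) \<le> M * vol (ball p (\<rho> + L)) / (1 - \<eta>)"
proof -
  let ?b = "vol (ball p (\<rho> + L))"
  define V where "V = (\<Sum>a\<in>T. v (c a))"
  define s where "s a = sqrt (v (c a))" for a
  have b: "?b > 0" using \<rho> L by (simp add: content_ball)
  have v: "v i > 0" for i using \<mu> less_le_trans by blast
  have s_pos: "s a > 0" and s_sq: "s a * s a = v (c a)" for a
    using v[of "c a"] by (auto simp: s_def)
  have M0: "0 \<le> M" using diagonal_nonneg order_trans[OF _ M] by blast
  have ratio: "0 \<le> 1 - (\<rho> / (\<rho> + L)) ^ CARD('n)"
    using \<rho> L by (simp add: power_le_one)
  have \<eta>0: "0 \<le> \<eta> * \<mu>"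
    using ratio \<mu>(1) max_tail_nonneg by (simp add: \<eta>_def)
  have "V\<^sup>2 \<le> (\<Sum>a\<in>T. \<Sum>b\<in>T. s a * mass (c a) (c b) * s b)"
  proof -
    \<comment> \<open>Since \<open>v i\<close> is the square of \<open>sqrt (v i)\<close>,
      \<open>V\<close> is the linear form of \<open>mass_ge\<close> evaluated at the sums of weights
      by type.\<close>
    have "V = (\<Sum>i\<in>UNIV. \<Sum>a\<in>{a\<in>T. c a = i}. s a * s a)"
      unfolding V_def using T by (subst sum.group) (auto simp: s_sq)
    also have "\<dots> = (\<Sum>i\<in>UNIV. (\<Sum>a\<in>{a\<in>T. c a = i}. s a) * sqrt (v i))"
      unfolding sum_distrib_right by (intro sum.cong refl) (auto simp: s_def)
    finally have "V\<^sup>2 \<le> (\<Sum>i\<in>UNIV. \<Sum>j\<in>UNIV. (\<Sum>a\<in>{a\<in>T. c a = i}. s a) * mass i j * (\<Sum>a\<in>{a\<in>T. c a = j}. s a))"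
      using mass_ge by simp
    then show ?thesis
      by (simp only: sum_bilinear_group[OF T])
  qed
  then have "V\<^sup>2 / ?b \<le> (\<Sum>a\<in>T. \<Sum>b\<in>T. s a * mass (c a) (c b) * s b) / ?b"
    using b by (simp add: divide_right_mono)
  also have "\<dots> \<le> (\<Sum>a\<in>T. \<Sum>b\<in>T. s a * s b * g (c a) (c b) (t b - t a)) + (\<Sum>a\<in>T. s a)\<^sup>2 * (\<eta> * \<mu> / ?b)"
    using point_form_lower_bound[where c=c and s=s and t=t, OF T _ t \<rho> L] less_imp_le[OF s_pos] \<mu>(1) by (simp add: \<eta>_def)
  also have "\<dots> \<le> M * V + V\<^sup>2 / \<mu> * (\<eta> * \<mu> / ?b)"
  proof (intro add_mono mult_right_mono)
    have "(\<Sum>b\<in>T. s a * s b * g (c a) (c b) (t b - t a)) \<le> M * v (c a)" if a: "a \<in> T" for a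
    proof -
      \<comment> \<open>Terms with \<open>b\<close> different from \<open>a\<close> are at most
        \<open>0\<close> by \<open>nonpos\<close>; the diagonal term is \<open>v (c a)\<close> times
        a diagonal value at the origin.\<close>
      have "(\<Sum>b\<in>T. s a * s b * g (c a) (c b) (t b - t a)) \<le> (\<Sum>b\<in>T. if b = a then M * v (c a) else 0)"
      proof (rule sum_mono)
        fix b assume b: "b \<in> T"
        show "s a * s b * g (c a) (c b) (t b - t a) \<le> (if b = a then M * v (c a) else 0)"
        proof (cases "b = a")
          case True
          then show ?thesis using v[of "c a"] M[of "c a"] by (simp add: s_sq mult.commute)
        next
          case False
          then show ?thesis using nonpos[OF a b] s_pos[of a] s_pos[of b] by (simp add: mult_nonneg_nonpos)
        qed
      qed
      then show ?thesis using T a by simp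
    qed
    then show "(\<Sum>a\<in>T. \<Sum>b\<in>T. s a * s b * g (c a) (c b) (t b - t a)) \<le> M * V"
      unfolding V_def sum_distrib_left by (rule sum_mono)
    have "(\<Sum>a\<in>T. s a) \<le> V / sqrt \<mu>"
      unfolding V_def sum_divide_distrib
    proof (rule sum_mono)
      fix a
      have "s a * sqrt \<mu> \<le> s a * s a"
        using s_pos[of a] \<mu>(2)[of "c a"] by (intro mult_left_mono) (auto simp: s_def)
      then show "s a \<le> v (c a) / sqrt \<mu>"
        using \<mu>(1) by (simp add: s_sq field_simps)
    qed
    moreover have "0 \<le> (\<Sum>a\<in>T. s a)"
      by (intro sum_nonneg less_imp_le s_pos)
    ultimately have "(\<Sum>a\<in>T. s a)\<^sup>2 \<le> (V / sqrt \<mu>)\<^sup>2"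
      by (rule power_mono)
    then show "(\<Sum>a\<in>T. s a)\<^sup>2 \<le> V\<^sup>2 / \<mu>"
      using \<mu>(1) by (simp add: power_divide)
    show "0 \<le> \<eta> * \<mu> / ?b" using \<eta>0 b by simp
  qed
  finally have "V\<^sup>2 / ?b \<le> M * V + \<eta> * V\<^sup>2 / ?b"
    using \<mu>(1) by (simp add: mult.commute)
  then have *: "V * (V * (1 - \<eta>)) \<le> V * (M * ?b)"
    using b by (simp add: field_simps power2_eq_square)
  have "0 \<le> V"
    unfolding V_def by (intro sum_nonneg less_imp_le v)
  \<comment> \<open>A positive \<open>V\<close> cancels; for \<open>V = 0\<close> the claim needs
    \<open>0 \<le> M\<close>, which comes from \<open>diagonal_nonneg\<close>.\<close>
  then have "V * (1 - \<eta>) \<le> M * ?b"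
    using * M0 b by (cases "V = 0") auto
  then show ?thesis
    unfolding V_def[symmetric] using \<eta> by (simp add: pos_le_divide_eq)
qed

end

section \<open>Volumes of translates and of convex bodies\<close>

lemma measure_lborel_translation:
  assumes "S \<in> sets borel"
  shows "measure lborel ((+) t ` S) = measure lborel (S :: 'a::euclidean_space set)"
proof -
  have "(+) t ` S = (\<lambda>x. - t + x) -` S" by (auto simp: image_iff algebra_simps intro!: bexI[of _ "- t + _"])
  moreover have "distr lborel borel (\<lambda>x. - t + x) = (lborel :: 'a measure)"
    using lborel_affine[of 1 "- t"] by (simp add: density_1)
  ultimately show ?thesis
    using assms measure_distr[of "\<lambda>x. - t + x" lborel borel S] by simp
qed

text \<open>The frontier of a convex set is a null set, and a nonempty interior contains a
  ball.\<close>

lemma convex_body_measure_interior: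
  assumes "convex_body K"
  shows "vol (interior K) = vol K" "vol K > 0"
proof -
  have K: "compact K" "convex K" "interior K \<noteq> {}"
    using assms by (auto simp: convex_body_def)
  have Kb: "K \<in> sets borel" using K(1) by (simp add: compact_imp_closed)
  have "frontier K \<in> null_sets lborel"
    using negligible_convex_frontier[OF K(2)] by (simp add: negligible_iff_null_sets null_sets_completion_iff)
  then have "measure lborel (interior K \<union> frontier K) = vol (interior K)"
    by (intro measure_Un_null_set) auto
  moreover have "interior K \<union> frontier K = K"
    using K(1) interior_subset by (auto simp: frontier_def compact_imp_closed)
  ultimately show eq: "vol (interior K) = vol K" by simp
  obtain x e where e: "e > 0" "ball x e \<subseteq> interior K"
    using K(3) by (meson all_not_in_conv open_contains_ball open_interior)
  have "0 < vol (ball x e)" using e(1) by (simp add: content_ball)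
  also have "\<dots> \<le> vol (interior K)"
  proof (rule measure_mono_fmeasurable[OF e(2)])
    show "interior K \<in> fmeasurable lborel"
      by (rule fmeasurableI2[OF fmeasurable_compact[OF K(1)] interior_subset]) simp
  qed simp
  finally show "vol K > 0" by (simp add: eq)
qed

section \<open>The density bound\<close>

text \<open>The subtracted rank one matrix contributes exactly the squared modulus on the left. This
  serves both positivity at frequency \<open>0\<close> and the lower bound by the squared total
  volume.\<close>

lemma psd_minus_rank_one:
  fixes A :: "'m::finite \<Rightarrow> 'm \<Rightarrow> complex" and a :: "'m \<Rightarrow> real"
  assumes "psd (\<chi> i j. A i j - of_real (a i * a j))"
  shows "(cmod (\<Sum>i\<in>UNIV. of_real (a i) * v i))\<^sup>2 \<le> Re (\<Sum>i\<in>UNIV. \<Sum>j\<in>UNIV. cnj (v i) * A i j * v j)"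
proof -
  let ?z = "\<Sum>i\<in>UNIV. of_real (a i) * v i"
  have "(\<Sum>i\<in>UNIV. \<Sum>j\<in>UNIV. cnj (v i) * (A i j - of_real (a i * a j)) * v j) =
    (\<Sum>i\<in>UNIV. \<Sum>j\<in>UNIV. cnj (v i) * A i j * v j) - cnj ?z * ?z"
  proof -
    have "cnj ?z * ?z = (\<Sum>i\<in>UNIV. \<Sum>j\<in>UNIV. cnj (v i) * of_real (a i * a j) * v j)"
      unfolding cnj_sum sum_product by (intro sum.cong refl) (simp add: mult_ac)
    then show ?thesis
      by (simp only: right_diff_distrib left_diff_distrib sum_subtractf)
  qed
  moreover have "0 \<le> Re (\<Sum>i\<in>UNIV. \<Sum>j\<in>UNIV. cnj (v i) * (A i j - of_real (a i * a j)) * v j)"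
    using assms[unfolded psd_def, THEN conjunct2, rule_format, of "\<chi> i. v i"]
    by (simp add: complex_nonneg_Reals_iff)
  moreover have "Re (cnj ?z * ?z) = (cmod ?z)\<^sup>2"
    by (metis Re_complex_of_real complex_norm_square mult.commute)
  ultimately show ?thesis
    by simp
qed

text \<open>The copies serve as their own indices, so distinct indices have disjoint interiors;
  shifting by \<open>- t A\<close> brings this into the form of hypothesis (iii). As each body lies
  in \<open>ball 0 \<rho>\<close>, a copy meeting \<open>ball p r\<close> is translated by a vector
  within \<open>r + \<rho>\<close> of \<open>p\<close>.\<close>

lemma translates_meeting_ball:
  fixes K :: "'m::finite \<Rightarrow> (real ^ 'n::finite) set"
  assumes bodies: "\<And>i. convex_body (K i)"
    and C: "C \<subseteq> {(+) t ` K i | t i. True}" and disj: "pairwise (\<lambda>A B. disjnt (interior A) (interior B)) C"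
    and \<rho>: "\<And>i. K i \<subseteq> ball 0 \<rho>" and \<mu>: "\<mu> > 0" "\<And>i. \<mu> \<le> vol (K i)"
  shows "\<exists>(T :: (real ^ 'n) set set) t c. finite T \<and> (\<forall>A\<in>T. t A \<in> ball p (r + \<rho>)) \<and>
    (\<forall>A\<in>T. \<forall>B\<in>T. A \<noteq> B \<longrightarrow> interior (K (c A)) \<inter> (+) (t B - t A) ` interior (K (c B)) = {}) \<and>
    vol (ball p r \<inter> \<Union>C) \<le> (\<Sum>A\<in>T. vol (K (c A)))"
proof -
  have "\<forall>A\<in>C. \<exists>t i. A = (+) t ` K i" using C by blast
  then obtain t c where tc: "\<And>A. A \<in> C \<Longrightarrow> A = (+) (t A) ` K (c A)"
    by metis
  define T where "T = {A \<in> C. A \<inter> ball p r \<noteq> {}}"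
  have compact: "compact A" if "A \<in> C" for A
    by (subst tc[OF that]) (use bodies[of "c A"] in \<open>auto simp: convex_body_def intro: compact_translation\<close>)
  have int: "interior A = (+) (t A) ` interior (K (c A))" if "A \<in> C" for A
    by (rule trans[OF arg_cong[where f=interior, OF tc[OF that]] interior_translation])
  have t_near: "t A \<in> ball p (r + \<rho>)" if "A \<in> T" for A
  proof -
    from that obtain z where z: "A \<in> C" "z \<in> A" "z \<in> ball p r"
      by (auto simp: T_def)
    have "z \<in> (+) (t A) ` K (c A)"
      using tc[OF z(1)] z(2) by (rule subst)
    then obtain y where "y \<in> K (c A)" "t A + y \<in> ball p r"
      using z(3) by auto
    then have "norm y < \<rho>" "dist p (t A + y) < r"
      using \<rho>[of "c A"] by auto
    then show ?thesis
      using norm_triangle_ineq[of "p - (t A + y)" y] by (simp add: dist_norm)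
  qed
  have A_near: "A \<subseteq> ball p (r + \<rho> + \<rho>)" if "A \<in> T" for A
  proof -
    have "A = (+) (t A) ` K (c A)" using that tc by (simp add: T_def)
    also have "\<dots> \<subseteq> ball (t A) \<rho>"
      using \<rho>[of "c A"] by (auto simp: dist_norm)
    also have "\<dots> \<subseteq> ball p (r + \<rho> + \<rho>)"
      by (rule ball_subset_ball_add[OF t_near[OF that]])
    finally show ?thesis .
  qed
  \<comment> \<open>Volume count: disjoint interiors of volume at least \<open>\<mu>\<close> all lie
    in \<open>ball p (r + \<rho> + \<rho>)\<close>, which bounds the size of every finite subset of
    \<open>T\<close>.\<close>
  have card: "card G \<le> nat \<lfloor>vol (ball p (r + \<rho> + \<rho>)) / \<mu>\<rfloor>" if G: "G \<subseteq> T" "finite G" for G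
  proof -
    have GC: "A \<in> C" if "A \<in> G" for A using that G by (auto simp: T_def)
    have fm: "interior A \<in> fmeasurable lborel" if "A \<in> G" for A
      by (rule fmeasurableI2[OF fmeasurable_compact[OF compact[OF GC[OF that]]] interior_subset]) simp
    have "real (card G) * \<mu> = (\<Sum>A\<in>G. \<mu>)" by simp
    also have "\<dots> \<le> (\<Sum>A\<in>G. vol (interior A))"
    proof (rule sum_mono)
      fix A assume "A \<in> G"
      then show "\<mu> \<le> vol (interior A)"
        using int[OF GC] \<mu>(2)[of "c A"] convex_body_measure_interior(1)[OF bodies, of "c A"]
        by (simp add: measure_lborel_translation)
    qed
    also have "\<dots> = vol (\<Union>A\<in>G. interior A)"
      by (rule measure_UNION'[symmetric]) (use G fm GC disj in \<open>auto intro: pairwise_subset\<close>)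
    also have "\<dots> \<le> vol (ball p (r + \<rho> + \<rho>))"
    proof (rule measure_mono_fmeasurable)
      show "(\<Union>A\<in>G. interior A) \<subseteq> ball p (r + \<rho> + \<rho>)"
        using A_near G interior_subset by blast
      show "ball p (r + \<rho> + \<rho>) \<in> fmeasurable lborel"
        by (rule fmeasurableI2[OF fmeasurable_compact[OF compact_cball] ball_subset_cball]) simp
    qed (auto intro!: borel_open)
    finally have "real (card G) \<le> vol (ball p (r + \<rho> + \<rho>)) / \<mu>"
      using \<mu>(1) by (simp add: pos_le_divide_eq)
    then show ?thesis
      by (simp add: le_nat_iff le_floor_iff)
  qed
  have fin: "finite T"
    using finite_if_finite_subsets_card_bdd[of T] card by blast
  have sep: "interior (K (c A)) \<inter> (+) (t B - t A) ` interior (K (c B)) = {}"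
    if "A \<in> T" "B \<in> T" "A \<noteq> B" for A B
  proof -
    have "disjnt ((+) (t A) ` interior (K (c A))) ((+) (t B) ` interior (K (c B)))"
      using disj int that by (auto simp: pairwise_def T_def)
    then show ?thesis
      unfolding disjnt_iff by (force simp: image_iff algebra_simps)
  qed
  have vol_le: "vol (ball p r \<inter> \<Union>C) \<le> (\<Sum>A\<in>T. vol (K (c A)))"
  proof -
    have fm: "A \<in> fmeasurable lborel" if "A \<in> T" for A
      using compact that by (intro fmeasurable_compact) (simp add: T_def)
    have sets: "A \<in> sets borel" if "A \<in> T" for A
      using fmeasurableD[OF fm[OF that]] by simp
    \<comment> \<open>Only copies in \<open>T\<close> reach the ball; passing to this finite union
      also settles measurability.\<close>
    have "vol (ball p r \<inter> \<Union>C) = vol (ball p r \<inter> \<Union>T)"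
      by (rule arg_cong[where f=vol]) (auto simp: T_def)
    also have "\<dots> \<le> vol (\<Union>A\<in>T. A)"
      using fm fin by (intro measure_mono_fmeasurable fmeasurable.finite_UN) (auto intro!: sets.Int sets.finite_Union simp: sets)
    also have "\<dots> \<le> (\<Sum>A\<in>T. vol A)"
      using fin by (intro measure_UNION_le) (auto simp: sets)
    also have "\<dots> = (\<Sum>A\<in>T. vol (K (c A)))"
    proof (rule sum.cong[OF refl])
      fix A assume "A \<in> T"
      then have A: "A = (+) (t A) ` K (c A)" using tc by (simp add: T_def)
      have "K (c A) \<in> sets borel"
        using bodies[of "c A"] by (simp add: convex_body_def compact_imp_closed)
      then show "vol A = vol (K (c A))"
        by (subst A) (rule measure_lborel_translation)
    qed
    finally show ?thesis .
  qed
  show ?thesis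
    by (intro exI[of _ T] exI[of _ t] exI[of _ c] conjI ballI impI fin t_near sep vol_le)
qed

theorem theorem1p3:
  fixes K :: "'m::finite \<Rightarrow> (real ^ 'n::finite) set"
    and f :: "real ^ 'n \<Rightarrow> real ^ 'm ^ 'm"
    and P :: "(real ^ 'n) set"
  assumes bodies: "\<And>i. convex_body (K i)"
    and schwartz: "\<And>i j. schwartz (\<lambda>x. f x $ i $ j)"
    and psd_zero: "psd (\<chi> i j. fourier (\<lambda>x. of_real (f x $ i $ j)) 0
                         - of_real (sqrt (vol (K i)) * sqrt (vol (K j))))"
    and psd_nonzero: "\<And>u. u \<noteq> 0 \<Longrightarrow> psd (\<chi> i j. fourier (\<lambda>x. of_real (f x $ i $ j)) u)"
    and nonpos: "\<And>i j x. interior (K i) \<inter> (+) x ` interior (K j) = {} \<Longrightarrow> f x $ i $ j \<le> 0"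
    and packing: "translative_packing K P"
  shows "upper_density P \<le> ereal (Max (range (\<lambda>i. f 0 $ i $ i)))
       \<and> (\<forall>\<Delta>. has_density P \<Delta> \<longrightarrow> \<Delta> \<le> Max (range (\<lambda>i. f 0 $ i $ i)))"
proof -
  note zero_form = psd_minus_rank_one[OF psd_zero]
  interpret pos_def_kernel "\<lambda>i j x. f x $ i $ j"
  proof
    fix i j
    show "integrable lborel (\<lambda>x. f x $ i $ j)" by (rule schwartz_integrable[OF schwartz])
    show "continuous_on UNIV (\<lambda>x. f x $ i $ j)" by (rule schwartz_continuous[OF schwartz])
    show "bounded (range (\<lambda>x. f x $ i $ j))" by (rule schwartz_bounded[OF schwartz])
  next
    fix u and v :: "'m \<Rightarrow> complex"
    show "0 \<le> Re (\<Sum>i\<in>UNIV. \<Sum>j\<in>UNIV. cnj (v i) * fourier (\<lambda>x. of_real (f x $ i $ j)) u * v j)"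
    proof (cases "u = 0")
      case True
      then show ?thesis
        using order_trans[OF zero_le_power2 zero_form[of v]] by simp
    next
      case False
      from psd_nonzero[OF this, unfolded psd_def, THEN conjunct2, rule_format, of "\<chi> i. v i"]
      show ?thesis by (simp add: complex_nonneg_Reals_iff)
    qed
  qed
  define M where "M = Max (range (\<lambda>i. f 0 $ i $ i))"
  have M: "f 0 $ i $ i \<le> M" for i
    unfolding M_def by (intro Max_ge) auto
  define \<mu> where "\<mu> = Min (range (\<lambda>i. vol (K i)))"
  have \<mu>: "\<mu> > 0" "\<And>i. \<mu> \<le> vol (K i)"
    unfolding \<mu>_def using convex_body_measure_interior(2)[OF bodies] by (auto intro!: Min_le)
  have mass_ge: "(\<Sum>i\<in>UNIV. x i * sqrt (vol (K i)))\<^sup>2 \<le> (\<Sum>i\<in>UNIV. \<Sum>j\<in>UNIV. x i * mass i j * x j)" for x :: "'m \<Rightarrow> real"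
  proof -
    \<comment> \<open>At frequency \<open>0\<close> the exponential is \<open>1\<close>, so the
      entries are real and the complex inequality can be read on real vectors.\<close>
    have "fourier (\<lambda>x. of_real (f x $ i $ j)) 0 = of_real (mass i j)" for i j
      by (simp add: fourier_def mass_def)
    with zero_form[of "\<lambda>i. of_real (x i)"]
    have "(cmod (\<Sum>i\<in>UNIV. of_real (sqrt (vol (K i))) * of_real (x i)))\<^sup>2
      \<le> Re (\<Sum>i\<in>UNIV. \<Sum>j\<in>UNIV. of_real (x i) * of_real (mass i j) * of_real (x j))"
      by simp
    then show ?thesis
      by (simp only: of_real_mult[symmetric] of_real_sum[symmetric] norm_of_real power2_abs Re_complex_of_real)
         (simp add: mult.commute)
  qed
  obtain \<rho> where \<rho>: "\<rho> > 0" "\<And>i. K i \<subseteq> ball 0 \<rho>"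
  proof -
    have "bounded (\<Union>i. K i)"
      using bodies by (intro bounded_Union) (auto simp: convex_body_def compact_imp_bounded)
    then obtain b where "b > 0" "\<And>x. x \<in> (\<Union>i. K i) \<Longrightarrow> norm x < b"
      by (metis bounded_pos_less)
    then have "K i \<subseteq> ball 0 b" for i
      by (auto simp: subset_iff)
    with \<open>b > 0\<close> show ?thesis by (rule that)
  qed
  obtain C where C: "C \<subseteq> {(+) t ` K i | t i. True}" "pairwise (\<lambda>A B. disjnt (interior A) (interior B)) C" "P = \<Union>C"
    using packing unfolding translative_packing_def by blast
  (* The margin L = sqrt r tends to infinity but is negligible compared with r. *)
  define \<eta> where "\<eta> r = (3 * max_tail (sqrt r) + max_tail 0 * (1 - ((r + \<rho>) / (r + \<rho> + sqrt r)) ^ CARD('n))) / \<mu>" for r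
  \<comment> \<open>This is the bound of \<open>packing_volume_bound\<close> divided by
    \<open>vol (ball p r)\<close>. It does not involve \<open>p\<close>, as the supremum in
    \<open>upper_density\<close> demands.\<close>
  define G where "G r = M * ((r + \<rho> + sqrt r) / r) ^ CARD('n) / (1 - \<eta> r)" for r
  have ratio_le: "vol (ball p r \<inter> P) / vol (ball p r) \<le> G r" if r: "r > 0" and \<eta>: "\<eta> r < 1" for p r
  proof -
    have pos: "0 < r + \<rho>" "0 < sqrt r" using r \<rho> by auto
    obtain T :: "(real ^ 'n) set set" and t c where T: "finite T" "\<forall>A\<in>T. t A \<in> ball p (r + \<rho>)"
      and sep: "\<forall>A\<in>T. \<forall>B\<in>T. A \<noteq> B \<longrightarrow> interior (K (c A)) \<inter> (+) (t B - t A) ` interior (K (c B)) = {}"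
      and le: "vol (ball p r \<inter> \<Union>C) \<le> (\<Sum>A\<in>T. vol (K (c A)))"
      using translates_meeting_ball[OF bodies C(1,2) \<rho>(2) \<mu>, of p r] by (elim exE conjE)
    note le
    also have "(\<Sum>A\<in>T. vol (K (c A))) \<le> M * vol (ball p (r + \<rho> + sqrt r)) / (1 - \<eta> r)"
      unfolding \<eta>_def
      by (rule packing_volume_bound[where v="\<lambda>i. vol (K i)", OF T(1) bspec[OF T(2)] pos \<mu> mass_ge nonpos[OF sep[rule_format]] M])
         (use \<eta> in \<open>simp_all add: \<eta>_def\<close>)
    finally have "vol (ball p r \<inter> P) / vol (ball p r) \<le> M * vol (ball p (r + \<rho> + sqrt r)) / (1 - \<eta> r) / vol (ball p r)"
      unfolding C(3) by (rule divide_right_mono) simp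
    also have "\<dots> = G r"
      using r pos by (simp add: G_def content_ball power_divide)
    finally show ?thesis .
  qed
  have lims: "((\<lambda>r. (r + \<rho>) / r) \<longlongrightarrow> 1) at_top" "((\<lambda>r. (r + \<rho> + sqrt r) / r) \<longlongrightarrow> 1) at_top"
  proof -
    have 1: "((\<lambda>r. \<rho> / r) \<longlongrightarrow> 0) at_top"
      by (rule tendsto_divide_0[OF tendsto_const filterlim_at_top_imp_at_infinity[OF filterlim_ident]])
    have 2: "((\<lambda>r. inverse (sqrt r)) \<longlongrightarrow> 0) at_top"
      by (rule tendsto_inverse_0_at_top[OF sqrt_at_top])
    have "((\<lambda>r. 1 + \<rho> / r) \<longlongrightarrow> 1) at_top" "((\<lambda>r. 1 + \<rho> / r + inverse (sqrt r)) \<longlongrightarrow> 1) at_top"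
      using tendsto_add[OF tendsto_const 1, of 1] tendsto_add[OF tendsto_add[OF tendsto_const 1, of 1] 2] by simp_all
    moreover have "\<forall>\<^sub>F r in at_top. 1 + \<rho> / r = (r + \<rho>) / r"
      using eventually_gt_at_top[of 0] by eventually_elim (simp add: field_simps)
    moreover have "\<forall>\<^sub>F r in at_top. 1 + \<rho> / r + inverse (sqrt r) = (r + \<rho> + sqrt r) / r"
      using eventually_gt_at_top[of 0]
      by eventually_elim (simp add: add_divide_distrib sqrt_divide_self_eq)
    ultimately show "((\<lambda>r. (r + \<rho>) / r) \<longlongrightarrow> 1) at_top" "((\<lambda>r. (r + \<rho> + sqrt r) / r) \<longlongrightarrow> 1) at_top"
      by (auto elim: Lim_transform_eventually)
  qed
  have \<eta>_lim: "(\<eta> \<longlongrightarrow> 0) at_top"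
  proof -
    have "\<forall>\<^sub>F r in at_top. ((r + \<rho>) / r) / ((r + \<rho> + sqrt r) / r) = (r + \<rho>) / (r + \<rho> + sqrt r)"
      using eventually_gt_at_top[of 0] by eventually_elim simp
    then have "((\<lambda>r. (r + \<rho>) / (r + \<rho> + sqrt r)) \<longlongrightarrow> 1) at_top"
      using tendsto_divide[OF lims] by (auto elim: Lim_transform_eventually)
    moreover have "((\<lambda>r. max_tail (sqrt r)) \<longlongrightarrow> 0) at_top"
      by (rule filterlim_compose[OF max_tail_tendsto_0 sqrt_at_top])
    \<comment> \<open>The tail vanishes because the margin grows; the shell term vanishes because
      the margin is small relative to \<open>r\<close>, while \<open>max_tail 0\<close> is
      constant.\<close>
    ultimately have "(\<eta> \<longlongrightarrow> (3 * 0 + max_tail 0 * (1 - 1 ^ CARD('n))) / \<mu>) at_top"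
      unfolding \<eta>_def using \<mu>(1) by (intro tendsto_intros) auto
    then show ?thesis by simp
  qed
  have G_lim: "(G \<longlongrightarrow> M) at_top"
  proof -
    have "(G \<longlongrightarrow> M * 1 ^ CARD('n) / (1 - 0)) at_top"
      unfolding G_def by (intro tendsto_intros lims \<eta>_lim) auto
    then show ?thesis by simp
  qed
  \<comment> \<open>As \<open>\<eta>\<close> tends to \<open>0\<close>, eventually
    \<open>\<eta> r < 1\<close>, and then the bound holds for all centres simultaneously.\<close>
  have ev: "\<forall>\<^sub>F r in at_top. \<forall>p. vol (ball p r \<inter> P) / vol (ball p r) \<le> G r"
    using eventually_gt_at_top[of 0] order_tendstoD(2)[OF \<eta>_lim zero_less_one]
    by eventually_elim (use ratio_le in blast)
  have "upper_density P \<le> Limsup at_top (\<lambda>r. ereal (G r))"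
    unfolding upper_density_def
    by (rule Limsup_mono) (use ev in \<open>eventually_elim, auto intro: SUP_least\<close>)
  also have "\<dots> = ereal M"
    using G_lim by (intro lim_imp_Limsup) auto
  finally have "upper_density P \<le> ereal M" .
  moreover have "\<Delta> \<le> M" if "has_density P \<Delta>" for \<Delta>
  proof (rule tendsto_le[OF _ G_lim])
    \<comment> \<open>A density is the limit at every centre, so comparison at the origin
      suffices.\<close>
    show "((\<lambda>r. vol (ball 0 r \<inter> P) / vol (ball (0 :: real ^ 'n) r)) \<longlongrightarrow> \<Delta>) at_top"
      by (rule that[unfolded has_density_def, rule_format])
    show "\<forall>\<^sub>F r in at_top. vol (ball 0 r \<inter> P) / vol (ball (0 :: real ^ 'n) r) \<le> G r"
      using ev by eventually_elim blast
  qed simp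
  ultimately show ?thesis
    by (simp add: M_def)
qed

end
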